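(* Let $Q(v_a,v_b,v_c,v_d)$ be a hyperbolic Lambert quadrilateral in the unit disk $\mathbb{B}^2$, and let the quadruple of interior angles $(\frac{\pi}{2},\frac{\pi}{2},\phi,\frac{\pi}{2})$, $\phi\in[0,\pi/2)$, correspond to the quadruple $(v_a,v_b,v_c,v_d)$ of vertices. Let $d_1=d_\rho(J[v_a,v_d],J[v_b,v_c])$, $d_2=d_\rho(J[v_a,v_b],J[v_c,v_d])$, and let $L=\tanh\rho(v_a,v_c)\in(0,1]$. When $L>\sqrt{2/3}$, let $m=\sqrt{(2-L^2)(3L^2-2)}$, $r_0=\sqrt{\frac{1-m/L^2}{2}}$ and $r_0'=\sqrt{1-r_0^2}$. (1) If $0<L\le\sqrt{\frac23}$, then $$\operatorname{artanh}L<d_1+d_2\le\operatorname{artanh}\left(\frac{2\sqrt2L}{2+L^2}\right).$$ Equality holds in the right-hand side if and only if $v_c$ is on the bisector of the interior angle at $v_a$. (2) If $\sqrt{\frac23}<L<\sqrt{2(\sqrt2-1)}$, then $$\operatorname{artanh}L<d_1+d_2\le\operatorname{artanh}\left(\frac{L(r_0+r_0')}{1+L^2r_0r_0'}\right).$$ Equality holds in the right-hand side if and only if the interior angle between $J[v_a,v_b]$ and $J[v_a,v_c]$ is $\arccos r_0$ or $\arccos r_0'$. (3) If $\sqrt{2(\sqrt2-1)}\le L<1$, then $$\operatorname{artanh}\left(\frac{2\sqrt2L}{2+L^2}\right)\le d_1+d_2\le\operatorname{artanh}\left(\frac{L(r_0+r_0')}{1+L^2r_0r_0'}\right).$$ Equality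 holds in the left-hand side if and only if $v_c$ is on the bisector of the interior angle at $v_a$. Equality holds in the right-hand side if and only if the interior angle between $J[v_a,v_b]$ and $J[v_a,v_c]$ is $\arccos r_0$ or $\arccos r_0'$. (4) If $L=1$, then $$d_1+d_2\ge\operatorname{artanh}\left(\frac{2\sqrt2}{3}\right).$$ Equality holds if and only if $v_c$ is on the bisector of the interior angle at $v_a$.
   Context: $\mathbb{B}^2$ is the open unit disk in the plane with the hyperbolic metric $\rho$ of weight $2/(1-|x|^2)$, i.e. $\tanh\frac{\rho(x,y)}{2}=\frac{|x-y|}{\sqrt{|x-y|^2+(1-|x|^2)(1-|y|^2)}}$. Hyperbolic geodesic lines are the sets $C\cap\mathbb{B}^2$ where $C$ is a circle perpendicular to the unit circle or a Euclidean line through $0$. $J[a,b]$ is the hyperbolic geodesic segment joining $a$ and $b$ when $a,b\in\mathbb{B}^2$, or the hyperbolic geodesic ray when one of the two points is on $\partial\mathbb{B}^2$. For nonempty $A,B\subset\mathbb{B}^2$, $d_\rho(A,B)=\inf_{x\in A,\,y\in B}\rho(x,y)$. A hyperbolic quadrilateral $Q(a,b,c,d)$ is given by four points of the closed unit disk such that the hyperbolic geodesics joining $\{a,b\},\{b,c\},\{c,d\},\{d,a\}$ bound a domain $D\subset\mathbb{B}^2$ with $a,b,c,d$ in positive order on the boundary of $D$. It is a Lambert quadrilateral if its angles are $\pi/2,\pi/2,\pi/2,\phi$ with $0\le\phi<\pi/2$; the vertex with angle $\phi$ may be on the unit circle, in which case $\phi=0$. If $v_c\in\partial\mathbb{B}^2$,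 then $\rho(v_a,v_c)=\infty$ and $L=1$. *)

theory Defs
  imports "HOL-Complex_Analysis.Complex_Analysis" "HOL-Library.Multiset"
begin

abbreviation unit_disk :: "complex set"
  where "unit_disk \<equiv> ball 0 1"

text \<open>The hyperbolic metric of weight \<open>2 / (1 - |x|\<^sup>2)\<close>. Only meaningful for points of the open disk:
  for a boundary point the argument of \<^const>\<open>artanh\<close> is 1, and HOL's total \<^const>\<open>artanh\<close> does not
  take the value \<open>\<infinity>\<close> there.\<close>

definition hyp_dist :: "complex \<Rightarrow> complex \<Rightarrow> real"
  where "hyp_dist x y =
    2 * artanh (norm (x - y) / sqrt ((norm (x - y))\<^sup>2 + (1 - (norm x)\<^sup>2) * (1 - (norm y)\<^sup>2)))"

definition hyp_setdist :: "complex set \<Rightarrow> complex set \<Rightarrow> real"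
  where "hyp_setdist A B = Inf {hyp_dist x y | x y. x \<in> A \<and> y \<in> B}"

text \<open>At a common point \<open>p\<close> the two circles have radius vectors \<open>p - z\<close> and \<open>p\<close>.\<close>

definition circle_perp_unit_circle :: "complex set \<Rightarrow> bool"
  where "circle_perp_unit_circle C \<longleftrightarrow>
    (\<exists>z r. r > 0 \<and> C = sphere z r \<and> C \<inter> sphere 0 1 \<noteq> {} \<and>
      (\<forall>p \<in> C \<inter> sphere 0 1. orthogonal (p - z) p))"

definition line_through_origin :: "complex set \<Rightarrow> bool"
  where "line_through_origin C \<longleftrightarrow> (\<exists>u. u \<noteq> 0 \<and> C = span {u})"

definition geodesic_line :: "complex set \<Rightarrow> bool"
  where "geodesic_line l \<longleftrightarrow>
    (\<exists>C. (circle_perp_unit_circle C \<or> line_through_origin C) \<and> l = C \<inter> unit_disk)"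

text \<open>The closure of a geodesic line is the line together with its two endpoints on the unit circle.
  It is itself an arc, so distinct points \<open>a\<close>, \<open>b\<close> on it determine the image of \<open>g\<close> below.\<close>

definition geodesic_arc :: "(real \<Rightarrow> complex) \<Rightarrow> complex \<Rightarrow> complex \<Rightarrow> bool"
  where "geodesic_arc g a b \<longleftrightarrow>
    arc g \<and> pathstart g = a \<and> pathfinish g = b \<and> (\<exists>l. geodesic_line l \<and> path_image g \<subseteq> closure l)"

text \<open>For \<open>a \<noteq> b\<close> in the closed disk: the geodesic segment, ray or line joining \<open>a\<close> and \<open>b\<close>, as a
  subset of the open disk (so endpoints on the unit circle are left out).\<close>

definition hyp_J :: "complex \<Rightarrow> complex \<Rightarrow> complex set"
  where "hyp_J a b = {z \<in> unit_disk. \<exists>g. geodesic_arc g a b \<and> z \<in> path_image g}"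

text \<open>The unit tangent vector at \<open>p\<close> of \<open>hyp_J p a\<close>, pointing towards \<open>a\<close>; here \<open>p\<close> may be on the
  unit circle.\<close>

definition geodesic_dir :: "complex \<Rightarrow> complex \<Rightarrow> complex"
  where "geodesic_dir p a = Lim (at p within hyp_J p a) (\<lambda>z. sgn (z - p))"

text \<open>The angle in \<open>[0, 2\<pi>)\<close> swept counterclockwise at \<open>p\<close> from \<open>hyp_J p a\<close> to \<open>hyp_J p b\<close>.
  At a point of the unit circle all geodesics have the same direction, which gives angle 0.\<close>

definition ccw_angle :: "complex \<Rightarrow> complex \<Rightarrow> complex \<Rightarrow> real"
  where "ccw_angle p a b = Arg2pi (geodesic_dir p b / geodesic_dir p a)"

text \<open>The bisector as a geodesic ray from \<open>p\<close>, including its endpoint on the unit circle.\<close>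

definition angle_bisector :: "complex \<Rightarrow> complex \<Rightarrow> complex \<Rightarrow> complex set"
  where "angle_bisector p a b =
    insert p {z \<in> cball 0 1. z \<noteq> p \<and> ccw_angle p a z = ccw_angle p a b / 2}"

text \<open>Positive order of the vertices on the boundary of \<open>D\<close> means that the boundary loop winds once
  counterclockwise around \<open>D\<close>.\<close>

definition hyp_quadrilateral :: "complex \<Rightarrow> complex \<Rightarrow> complex \<Rightarrow> complex \<Rightarrow> bool"
  where "hyp_quadrilateral a b c d \<longleftrightarrow>
    {a, b, c, d} \<subseteq> cball 0 1 \<and>
    (\<exists>g1 g2 g3 g4 D.
      geodesic_arc g1 a b \<and> geodesic_arc g2 b c \<and> geodesic_arc g3 c d \<and> geodesic_arc g4 d a \<and>
      simple_path (g1 +++ g2 +++ g3 +++ g4) \<and>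
      open D \<and> connected D \<and> D \<noteq> {} \<and> D \<subseteq> unit_disk \<and>
      frontier D = path_image (g1 +++ g2 +++ g3 +++ g4) \<and>
      (\<forall>z\<in>D. winding_number (g1 +++ g2 +++ g3 +++ g4) z = 1))"

text \<open>For vertices in positive order the domain lies to the left of the boundary loop, so the interior
  angle is swept counterclockwise from the side towards the next vertex to the side towards the
  previous one.\<close>

definition interior_angle :: "complex \<Rightarrow> complex \<Rightarrow> complex \<Rightarrow> real"
  where "interior_angle prev v nxt = ccw_angle v nxt prev"

definition lambert_quadrilateral :: "complex \<Rightarrow> complex \<Rightarrow> complex \<Rightarrow> complex \<Rightarrow> bool"
  where "lambert_quadrilateral a b c d \<longleftrightarrow>
    hyp_quadrilateral a b c d \<and>
    (\<exists>\<phi>. 0 \<le> \<phi> \<and> \<phi> < pi / 2 \<and>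
      {#interior_angle d a b, interior_angle a b c, interior_angle b c d, interior_angle c d a#}
        = {#pi / 2, pi / 2, pi / 2, \<phi>#})"

end

theory Submission
  imports Defs
begin

text \<open>The Moebius map \<open>mob p z = (z - p) / (1 - cnj p * z)\<close> sends \<open>p\<close> to \<open>0\<close>, turns geodesics through
  \<open>p\<close> into diameters and preserves directions at \<open>p\<close>. Hence \<open>hyp_J p a\<close> is the preimage of the radius
  towards \<open>mob p a\<close>, and the direction of that geodesic is \<open>sgn (mob p a)\<close>. After moving \<open>va\<close> to \<open>0\<close>, the
  right angles at \<open>vb\<close> and \<open>vd\<close> become the equations of two geodesics perpendicular to the coordinate
  axes, and they give \<open>tanh d1 = L * cos \<theta>\<close> and \<open>tanh d2 = L * sin \<theta>\<close>, where \<open>\<theta>\<close> is the angle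
  between \<open>J[va,vb]\<close> and \<open>J[va,vc]\<close>. Therefore \<open>tanh (d1 + d2) = 2 L s / (2 - L\<^sup>2 + L\<^sup>2 s\<^sup>2)\<close> with
  \<open>s = cos \<theta> + sin \<theta> \<in> (1, \<surd>2]\<close>, a function of \<open>s\<close> that increases as long as \<open>L\<^sup>2 s\<^sup>2 < 2 - L\<^sup>2\<close> and
  decreases afterwards.\<close>

section \<open>Moebius maps and geodesics\<close>

abbreviation mob :: "complex \<Rightarrow> complex \<Rightarrow> complex"
  where "mob \<equiv> Moebius_function 0"

section \<open>Disk automorphisms and the hyperbolic distance\<close>

lemma one_minus_cnj_mult_neq_0:
  assumes "norm p < 1" "norm z \<le> 1"
  shows "1 - cnj p * z \<noteq> 0"
proof
  assume "1 - cnj p * z = 0"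
  then have "norm (cnj p * z) = 1" by simp
  moreover have "norm (cnj p * z) \<le> norm p * 1"
    using assms by (simp add: norm_mult mult_left_le)
  ultimately show False using assms by simp
qed

text \<open>The right-hand side is the radicand in \<open>hyp_dist\<close>, so the square root there
  is the modulus of the denominator of \<open>mob p z\<close>, and \<open>hyp_dist\<close> becomes a
  function of \<open>norm (mob p z)\<close>.\<close>

lemma norm_one_minus_cnj_mult:
  "(norm (1 - cnj p * z))\<^sup>2 = (norm (z - p))\<^sup>2 + (1 - (norm p)\<^sup>2) * (1 - (norm z)\<^sup>2)"
  by (simp add: cmod_power2, simp add: power2_eq_square algebra_simps)

lemma one_minus_norm_mob:
  assumes "norm p < 1" "norm z \<le> 1"
  shows "1 - (norm (mob p z))\<^sup>2 = (1 - (norm p)\<^sup>2) * (1 - (norm z)\<^sup>2) / (norm (1 - cnj p * z))\<^sup>2"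
  using one_minus_cnj_mult_neq_0[OF assms] norm_one_minus_cnj_mult[of p z]
  by (simp add: Moebius_function_simple norm_divide power_divide field_simps)

lemma norm_mob_le_1:
  assumes "norm p < 1" "norm z \<le> 1"
  shows "norm (mob p z) \<le> 1"
proof -
  have "1 - (norm (mob p z))\<^sup>2 \<ge> 0"
    unfolding one_minus_norm_mob[OF assms] using assms by (simp add: power_le_one)
  then show ?thesis by (simp add: abs_square_le_1)
qed

lemma norm_mob_less_1:
  assumes "norm p < 1" "norm z < 1"
  shows "norm (mob p z) < 1"
  using assms by (rule Moebius_function_norm_lt_1)

lemma mob_mob_uminus:
  assumes "norm p < 1" "norm z \<le> 1"
  shows "mob (- p) (mob p z) = z" "mob p (mob (- p) z) = z"
proof -
  have main: "mob (- q) (mob q z) = z" if "norm q < 1" for q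
  proof -
    have n: "1 - cnj q * z \<noteq> 0" "1 - cnj q * q \<noteq> 0"
      using one_minus_cnj_mult_neq_0[of q] that assms by auto
    have "mob (- q) (mob q z) = ((z - q) / (1 - cnj q * z) + q) / (1 + cnj q * ((z - q) / (1 - cnj q * z)))"
      by (simp add: Moebius_function_simple)
    also have "(z - q) / (1 - cnj q * z) + q = z * (1 - cnj q * q) / (1 - cnj q * z)"
      using n by (simp add: field_simps)
    also have "1 + cnj q * ((z - q) / (1 - cnj q * z)) = (1 - cnj q * q) / (1 - cnj q * z)"
      using n by (simp add: field_simps)
    finally show ?thesis using n by simp
  qed
  show "mob (- p) (mob p z) = z" using main[of p] assms by simp
  show "mob p (mob (- p) z) = z" using main[of "- p"] assms by simp
qed

lemma mob_self [simp]: "mob p p = 0"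
  by (simp add: Moebius_function_simple)

lemma mob_eq_0_iff:
  assumes "norm p < 1" "norm z \<le> 1"
  shows "mob p z = 0 \<longleftrightarrow> z = p"
  using one_minus_cnj_mult_neq_0[OF assms] by (simp add: Moebius_function_simple)

text \<open>As functions of \<open>y\<close> both sides are disk automorphisms with the zero
  \<open>x\<close>, so they differ by a unimodular constant. As this constant is independent of
  \<open>y\<close>, moving \<open>a\<close> to 0 preserves distances from \<open>x\<close> and the
  angles at \<open>x\<close>.\<close>

lemma mob_conjugate:
  assumes "norm a < 1" "norm x < 1" "norm y \<le> 1"
  shows "mob (mob a x) (mob a y) = (1 - a * cnj x) / (1 - cnj a * x) * mob x y"
proof -
  have n: "1 - cnj a * x \<noteq> 0" "1 - cnj a * y \<noteq> 0" "1 - cnj x * y \<noteq> 0" "1 - cnj a * a \<noteq> 0"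
    using one_minus_cnj_mult_neq_0[of a] one_minus_cnj_mult_neq_0[of x] assms by auto
  have n2: "1 - a * cnj x \<noteq> 0"
    using n(1) by (metis complex_cnj_cnj complex_cnj_diff complex_cnj_mult complex_cnj_one
        complex_cnj_zero_iff)
  have 1: "mob a y - mob a x = (y - x) * (1 - cnj a * a) / ((1 - cnj a * y) * (1 - cnj a * x))"
    using n by (simp add: Moebius_function_simple divide_simps) (simp add: algebra_simps)
  have 2: "1 - cnj (mob a x) * mob a y
      = (1 - cnj a * a) * (1 - cnj x * y) / ((1 - a * cnj x) * (1 - cnj a * y))"
    using n n2 by (simp add: Moebius_function_simple divide_simps) (simp add: algebra_simps)
  have "mob (mob a x) (mob a y) = (mob a y - mob a x) / (1 - cnj (mob a x) * mob a y)"
    by (simp add: Moebius_function_simple)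
  also have "\<dots> = (1 - a * cnj x) / (1 - cnj a * x) * ((y - x) / (1 - cnj x * y))"
    unfolding 1 2 using n n2 by (simp add: divide_simps)
  finally show ?thesis by (simp add: Moebius_function_simple)
qed

lemma norm_mob_conjugate:
  assumes "norm a < 1" "norm x < 1" "norm y \<le> 1"
  shows "norm (mob (mob a x) (mob a y)) = norm (mob x y)"
proof -
  have "norm (1 - a * cnj x) = norm (1 - cnj a * x)"
    by (metis complex_cnj_cnj complex_cnj_diff complex_cnj_mult complex_cnj_one complex_mod_cnj)
  then show ?thesis
    using one_minus_cnj_mult_neq_0[of a x] assms
    by (simp add: mob_conjugate norm_mult norm_divide)
qed

lemma hyp_dist_eq_mob:
  assumes "norm x < 1" "norm y < 1"
  shows "hyp_dist x y = 2 * artanh (norm (mob x y))"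
proof -
  have "sqrt ((norm (x - y))\<^sup>2 + (1 - (norm x)\<^sup>2) * (1 - (norm y)\<^sup>2)) = norm (1 - cnj x * y)"
    by (metis norm_one_minus_cnj_mult norm_minus_commute norm_ge_zero real_sqrt_abs abs_of_nonneg)
  then show ?thesis
    by (simp add: hyp_dist_def Moebius_function_simple norm_divide norm_minus_commute)
qed

lemma continuous_on_mob:
  assumes "norm p < 1"
  shows "continuous_on (cball 0 1) (mob p)"
  unfolding Moebius_function_simple
  using one_minus_cnj_mult_neq_0[OF assms] by (intro continuous_intros) auto

text \<open>The case \<open>A = 0\<close> is a diameter; otherwise \<open>B / A\<close> is the centre of the circle.\<close>

lemma geodesic_line_equation:
  assumes "geodesic_line l"
  obtains A :: real and B :: complex where "\<bar>A\<bar> < norm B"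
    and "closure l \<subseteq> {z \<in> cball 0 1. A * (1 + (norm z)\<^sup>2) = 2 * (B \<bullet> z)}"
proof -
  note result = that
  have *: thesis
    if AB: "\<bar>A\<bar> < norm B" and l: "\<And>z. z \<in> l \<Longrightarrow> norm z < 1 \<and> A * (1 + (norm z)\<^sup>2) = 2 * (B \<bullet> z)"
    for A B
  proof (rule result[OF AB])
    have "closed (cball 0 1 \<inter> {z. A * (1 + (norm z)\<^sup>2) = 2 * (B \<bullet> z)})"
      by (intro closed_Int closed_cball closed_Collect_eq continuous_intros)
    moreover have "l \<subseteq> cball 0 1 \<inter> {z. A * (1 + (norm z)\<^sup>2) = 2 * (B \<bullet> z)}"
      using l by (simp add: subset_iff less_imp_le)
    ultimately have "closure l \<subseteq> cball 0 1 \<inter> {z. A * (1 + (norm z)\<^sup>2) = 2 * (B \<bullet> z)}"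
      by (intro closure_minimal)
    then show "closure l \<subseteq> {z \<in> cball 0 1. A * (1 + (norm z)\<^sup>2) = 2 * (B \<bullet> z)}" by blast
  qed
  obtain C where C: "circle_perp_unit_circle C \<or> line_through_origin C" "l = C \<inter> unit_disk"
    using assms unfolding geodesic_line_def by blast
  from C(1) show thesis
  proof
    assume "circle_perp_unit_circle C"
    then obtain z0 r p where r: "r > 0" "C = sphere z0 r" and p: "p \<in> C" "norm p = 1" "orthogonal (p - z0) p"
      unfolding circle_perp_unit_circle_def by fastforce
    have pz: "z0 \<bullet> p = 1"
      using p by (simp add: orthogonal_def inner_diff_left dot_square_norm)
    have "(norm (p - z0))\<^sup>2 = r\<^sup>2"
      using p r by (simp add: dist_norm norm_minus_commute)
    moreover have "(norm (p - z0))\<^sup>2 = (norm p)\<^sup>2 + (norm z0)\<^sup>2 - 2 * (z0 \<bullet> p)"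
      unfolding power2_norm_eq_inner by (simp add: inner_diff_left inner_diff_right inner_commute)
    ultimately have z0: "(norm z0)\<^sup>2 = 1 + r\<^sup>2" using p pz by simp
    have "1\<^sup>2 < (norm z0)\<^sup>2" using z0 r by simp
    then have "1 < norm z0" by (rule power2_less_imp_less) simp
    moreover have "1 * (1 + (norm z)\<^sup>2) = 2 * (z0 \<bullet> z)" if "z \<in> l" for z
    proof -
      have "(norm (z - z0))\<^sup>2 = r\<^sup>2"
        using that C r by (simp add: dist_norm norm_minus_commute)
      moreover have "(norm (z - z0))\<^sup>2 = (norm z)\<^sup>2 + (norm z0)\<^sup>2 - 2 * (z0 \<bullet> z)"
        unfolding power2_norm_eq_inner by (simp add: inner_diff_left inner_diff_right inner_commute)
      ultimately show ?thesis using z0 by simp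
    qed
    ultimately show thesis using C(2) by (intro *[of 1 z0]) auto
  next
    assume "line_through_origin C"
    then obtain u where u: "u \<noteq> 0" "C = span {u}"
      unfolding line_through_origin_def by blast
    show thesis
      by (rule *[of 0 "\<i> * u"]) (use u C(2) in \<open>auto simp: span_singleton norm_mult inner_complex_def\<close>)
  qed
qed

text \<open>Converse of \<open>geodesic_line_equation\<close>. For \<open>A = 0\<close> the equation
  describes the diameter in direction \<open>\<i> * B\<close>. Otherwise it describes the circle
  with centre \<open>B / A\<close> whose radius satisfies
  \<open>r\<^sup>2 + 1 = (norm z0)\<^sup>2\<close>, which is Pythagoras at a point of the unit
  circle.\<close>

lemma geodesic_line_intro:
  fixes A :: real and B :: complex
  assumes "\<bar>A\<bar> < norm B"
  shows "geodesic_line {z \<in> ball 0 1. A * (1 + (norm z)\<^sup>2) = 2 * (B \<bullet> z)}"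
proof (cases "A = 0")
  case True
  have "line_through_origin {z. B \<bullet> z = 0}"
    unfolding line_through_origin_def
  proof (intro exI conjI)
    show "\<i> * B \<noteq> 0" using assms by auto
    show "{z. B \<bullet> z = 0} = span {\<i> * B}"
    proof (intro equalityI subsetI)
      fix z assume "z \<in> {z. B \<bullet> z = 0}"
      then have "Im (z / (\<i> * B)) = 0"
        by (simp add: inner_complex_def Im_divide algebra_simps)
      then have "z / (\<i> * B) = of_real (Re (z / (\<i> * B)))"
        by (simp add: complex_eq_iff)
      then have "z = Re (z / (\<i> * B)) *\<^sub>R (\<i> * B)"
        unfolding scaleR_conv_of_real using \<open>\<i> * B \<noteq> 0\<close> by (metis nonzero_eq_divide_eq)
      then show "z \<in> span {\<i> * B}" by (metis rangeI span_singleton)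
    qed (auto simp: span_singleton inner_complex_def)
  qed
  then show ?thesis
    unfolding geodesic_line_def using True by (auto intro!: exI[of _ "{z. B \<bullet> z = 0}"])
next
  case False
  define z0 where "z0 = B / of_real A"
  define r where "r = sqrt ((norm z0)\<^sup>2 - 1)"
  have z0: "norm z0 > 1" using assms False by (simp add: z0_def norm_divide)
  then have "(norm z0)\<^sup>2 > 1" by (simp add: one_less_power)
  then have r: "r > 0" "r\<^sup>2 = (norm z0)\<^sup>2 - 1" by (auto simp: r_def)
  have on_sphere: "z \<in> sphere z0 r \<longleftrightarrow> 1 + (norm z)\<^sup>2 = 2 * (z0 \<bullet> z)" for z
  proof -
    have "z \<in> sphere z0 r \<longleftrightarrow> (norm (z - z0))\<^sup>2 = r\<^sup>2"
      using r(1) by (simp add: dist_norm norm_minus_commute)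
    also have "(norm (z - z0))\<^sup>2 = (norm z)\<^sup>2 + (norm z0)\<^sup>2 - 2 * (z0 \<bullet> z)"
      unfolding power2_norm_eq_inner by (simp add: inner_diff_left inner_diff_right inner_commute)
    finally show ?thesis using r by auto
  qed
  have B: "B = of_real A * z0" using False by (simp add: z0_def)
  have "circle_perp_unit_circle (sphere z0 r)"
    unfolding circle_perp_unit_circle_def
  proof (intro exI conjI ballI)
    show "r > 0" by fact
    show "sphere z0 r = sphere z0 r" ..
    \<comment> \<open>A common point must satisfy \<open>norm p = 1\<close> and
      \<open>z0 \<bullet> p = 1\<close>, that is, \<open>cnj z0 * p\<close> has real part 1 and
      modulus \<open>norm z0\<close>; its imaginary part is then \<open>r\<close> or
      \<open>- r\<close>.\<close>
    define p where "p = (1 + \<i> * of_real r) / cnj z0"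
    have "(norm p)\<^sup>2 = (1 + r\<^sup>2) / (norm z0)\<^sup>2"
      by (simp add: p_def norm_divide power_divide cmod_power2)
    then have "(norm p)\<^sup>2 = 1" using r z0 by auto
    then have p1: "norm p = 1" by (simp add: abs_square_eq_1)
    have "z0 \<bullet> p = Re (cnj z0 * p)" by (simp add: inner_complex_def)
    also have "cnj z0 * p = 1 + \<i> * of_real r" using z0 by (auto simp: p_def)
    finally have "z0 \<bullet> p = 1" by simp
    then have "p \<in> sphere z0 r \<inter> sphere 0 1" using p1 on_sphere[of p] by simp
    then show "sphere z0 r \<inter> sphere 0 1 \<noteq> {}" by blast
    show "orthogonal (q - z0) q" if "q \<in> sphere z0 r \<inter> sphere 0 1" for q
      using that on_sphere[of q]
      by (simp add: orthogonal_def inner_diff_left dot_square_norm)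
  qed
  moreover have "{z \<in> ball 0 1. A * (1 + (norm z)\<^sup>2) = 2 * (B \<bullet> z)} = sphere z0 r \<inter> unit_disk"
  proof -
    have "B \<bullet> z = A * (z0 \<bullet> z)" for z
      by (simp add: B inner_complex_def algebra_simps)
    then show ?thesis using False on_sphere by auto
  qed
  ultimately show ?thesis unfolding geodesic_line_def by blast
qed

text \<open>The diameter through \<open>c\<close> is given by \<open>Im (cnj c * w) = 0\<close>.
  Substituting \<open>w = mob p z\<close> and clearing the denominator gives an equation of the form
  \<open>A * (1 + (norm z)\<^sup>2) = 2 * (B \<bullet> z)\<close>, from which \<open>A\<close> and
  \<open>B\<close> are read off.\<close>

lemma radius_in_geodesic_line:
  assumes "norm p < 1" "c \<noteq> 0" "norm c \<le> 1"
  shows "\<exists>l. geodesic_line l \<and> (\<forall>t\<in>{0..1}. mob (- p) (of_real t * c) \<in> closure l)"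
proof -
  define A where "A = Im (cnj c * p)"
  define B where "B = \<i> * (c - cnj c * p\<^sup>2) / 2"
  define l where "l = {z \<in> ball 0 1. A * (1 + (norm z)\<^sup>2) = 2 * (B \<bullet> z)}"
  have "4 * ((norm B)\<^sup>2 - A\<^sup>2) = (norm c)\<^sup>2 * (1 - (norm p)\<^sup>2)\<^sup>2"
    by (simp add: A_def B_def cmod_power2 norm_mult norm_divide power_divide)
      (simp add: power2_eq_square field_simps)
  moreover have "(norm c)\<^sup>2 * (1 - (norm p)\<^sup>2)\<^sup>2 > 0"
    using assms by (auto simp: abs_square_eq_1)
  ultimately have "\<bar>A\<bar>\<^sup>2 < (norm B)\<^sup>2" by simp
  then have AB: "\<bar>A\<bar> < norm B" by (rule power2_less_imp_less) simp
  have eq: "Im (cnj c * mob p z) * (norm (1 - cnj p * z))\<^sup>2 = 2 * (B \<bullet> z) - A * (1 + (norm z)\<^sup>2)"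
    if "norm z < 1" for z
  proof -
    have n: "1 - cnj p * z \<noteq> 0" using one_minus_cnj_mult_neq_0[of p z] assms that by simp
    have "Im (cnj c * mob p z) * (norm (1 - cnj p * z))\<^sup>2
        = Im (cnj c * mob p z * of_real ((norm (1 - cnj p * z))\<^sup>2))" by simp
    also have "cnj c * mob p z * of_real ((norm (1 - cnj p * z))\<^sup>2)
        = cnj c * (z - p) * cnj (1 - cnj p * z)"
      unfolding complex_norm_square using n by (simp add: Moebius_function_simple)
    also have "Im \<dots> = 2 * (B \<bullet> z) - A * (1 + (norm z)\<^sup>2)"
      by (simp add: A_def B_def cmod_power2 inner_complex_def, simp add: power2_eq_square algebra_simps)
    finally show ?thesis .
  qed
  have norm_tc: "norm (of_real t * c) \<le> 1" if "t \<in> {0..1}" for t :: real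
    using that assms by (simp add: norm_mult mult_le_one)
  have norm_tc': "norm (of_real t * c) < 1" if "t \<in> {0..<1}" for t :: real
    using that assms mult_left_le[of "norm c" t] by (simp add: norm_mult)
  have sub: "(\<lambda>t. mob (- p) (of_real t * c)) ` {0..<1} \<subseteq> l"
  proof (rule image_subsetI)
    fix t :: real assume t: "t \<in> {0..<1}"
    let ?z = "mob (- p) (of_real t * c)"
    have z: "norm ?z < 1" using norm_mob_less_1[of "- p"] norm_tc'[OF t] assms by simp
    have "Im (cnj c * mob p ?z) = 0"
      using mob_mob_uminus(2)[of p "of_real t * c"] norm_tc'[OF t] assms by simp
    then show "?z \<in> l" using eq[OF z] z by (simp add: l_def)
  qed
  \<comment> \<open>The endpoint \<open>t = 1\<close> may land on the unit circle, outside the open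
    disk, so it is reached as a limit from the half-open interval.\<close>
  have cont: "continuous_on (closure {0..<1}) (\<lambda>t. mob (- p) (of_real t * c))"
    using norm_tc assms
    by (intro continuous_on_compose2[OF continuous_on_mob[of "- p"]]) (auto intro!: continuous_intros)
  have "(\<lambda>t. mob (- p) (of_real t * c)) ` closure {0..<1} \<subseteq> closure l"
    using image_closure_subset[OF cont closed_closure] sub closure_subset by blast
  then have "\<forall>t\<in>{0..1}. mob (- p) (of_real t * c) \<in> closure l" by auto
  then show ?thesis using geodesic_line_intro[OF AB] unfolding l_def by blast
qed

section \<open>Geodesic arcs from an interior point and the sets \<open>hyp_J\<close>\<close>

lemma geodesic_arc_radius:
  assumes "norm p < 1" "norm a \<le> 1" "a \<noteq> p"
  shows "geodesic_arc (\<lambda>t. mob (- p) (of_real t * mob p a)) p a"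
proof -
  define c where "c = mob p a"
  have c: "c \<noteq> 0" "norm c \<le> 1" "mob (- p) c = a"
    using assms mob_eq_0_iff norm_mob_le_1 mob_mob_uminus(1) by (auto simp: c_def)
  have norm_tc: "norm (of_real t * c) \<le> 1" if "t \<in> {0..1}" for t :: real
    using that c by (simp add: norm_mult mult_le_one)
  have "continuous_on {0..1} (\<lambda>t. mob (- p) (of_real t * c))"
    using norm_tc assms
    by (intro continuous_on_compose2[OF continuous_on_mob[of "- p"]]) (auto intro!: continuous_intros)
  moreover have "inj_on (\<lambda>t. mob (- p) (of_real t * c)) {0..1}"
  proof (rule inj_onI)
    fix s t :: real
    assume st: "s \<in> {0..1}" "t \<in> {0..1}" "mob (- p) (of_real s * c) = mob (- p) (of_real t * c)"
    then have "mob p (mob (- p) (of_real s * c)) = mob p (mob (- p) (of_real t * c))" by simp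
    then have "of_real s * c = of_real t * c"
      unfolding mob_mob_uminus(2)[OF assms(1) norm_tc[OF st(1)]]
        mob_mob_uminus(2)[OF assms(1) norm_tc[OF st(2)]] .
    then show "s = t" using c by simp
  qed
  moreover obtain l where "geodesic_line l" "\<forall>t\<in>{0..1}. mob (- p) (of_real t * c) \<in> closure l"
    using radius_in_geodesic_line[OF assms(1) c(1,2)] by blast
  moreover have "mob (- p) 0 = p" by (simp add: Moebius_function_simple)
  ultimately show ?thesis
    unfolding geodesic_arc_def c_def[symmetric]
    by (auto simp: arc_def path_def pathstart_def pathfinish_def path_image_def c(3))
qed

text \<open>Substituting \<open>z = mob (- p) w\<close> into the equation of the geodesic gives a
  multiple of \<open>1 + (norm w)\<^sup>2\<close>, which cancels because \<open>p\<close> lies on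
  the geodesic, and the linear term \<open>E \<bullet> w\<close>. So the image is a diameter with
  normal vector \<open>E\<close>.\<close>

lemma mob_geodesic_collinear:
  fixes A :: real and B p z :: complex
  assumes AB: "\<bar>A\<bar> < norm B" and p: "norm p < 1" "A * (1 + (norm p)\<^sup>2) = 2 * (B \<bullet> p)"
    and E: "E = B + cnj B * p\<^sup>2 - 2 * of_real A * p"
  shows "E \<noteq> 0"
    and "norm z \<le> 1 \<Longrightarrow> A * (1 + (norm z)\<^sup>2) = 2 * (B \<bullet> z) \<Longrightarrow> E \<bullet> mob p z = 0"
proof -
  show "E \<noteq> 0"
  proof
    assume "E = 0"
    then have 1: "2 * of_real A * p = B + cnj B * p\<^sup>2" using E by (simp add: algebra_simps)
    have "complex_of_real (2 * (B \<bullet> p)) = cnj B * p + B * cnj p"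
      by (simp add: complex_eq_iff inner_complex_def)
    then have 2: "of_real A * (1 + p * cnj p) = cnj B * p + B * cnj p"
      by (metis p(2) complex_norm_square of_real_1 of_real_add of_real_mult)
    \<comment> \<open>Multiply fact 2 by \<open>p\<close> and remove
      \<open>cnj B * p\<^sup>2\<close> with fact 1.\<close>
    have "(1 - p * cnj p) * (of_real A * p - B) = 0"
      using 1 2 by algebra
    moreover have "1 - p * cnj p \<noteq> 0"
      using one_minus_cnj_mult_neq_0[of p p] p(1) by (simp add: mult.commute)
    ultimately have "B = of_real A * p" by simp
    then have "norm B \<le> \<bar>A\<bar>" using p(1) by (simp add: norm_mult mult_left_le)
    then show False using AB by simp
  qed
  assume z: "norm z \<le> 1" "A * (1 + (norm z)\<^sup>2) = 2 * (B \<bullet> z)"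
  have n: "1 - cnj p * z \<noteq> 0" using one_minus_cnj_mult_neq_0 p(1) z(1) .
  have "(norm (1 - cnj p * z))\<^sup>2 * (E \<bullet> mob p z)
      = E \<bullet> (of_real ((norm (1 - cnj p * z))\<^sup>2) * mob p z)"
    by (simp add: inner_complex_def algebra_simps)
  also have "of_real ((norm (1 - cnj p * z))\<^sup>2) * mob p z = (z - p) * cnj (1 - cnj p * z)"
    unfolding complex_norm_square using n by (simp add: Moebius_function_simple)
  also have "E \<bullet> ((z - p) * cnj (1 - cnj p * z)) =
      (1 - (norm p)\<^sup>2)\<^sup>2 * (B \<bullet> z)
      + (4 * (p \<bullet> z) - (1 + (norm z)\<^sup>2) * (1 + (norm p)\<^sup>2)) * (B \<bullet> p)
      - 2 * A * ((1 + (norm p)\<^sup>2) * (p \<bullet> z) - (norm p)\<^sup>2 * (1 + (norm z)\<^sup>2))"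
    by (simp add: E inner_complex_def cmod_power2, simp add: power2_eq_square algebra_simps)
  also have "\<dots> = 0"
    using p(2) z(2) by algebra
  finally show "E \<bullet> mob p z = 0" using n by simp
qed

lemma inner_eq_0_collinear:
  fixes E W c :: complex
  assumes "E \<noteq> 0" "c \<noteq> 0" "E \<bullet> W = 0" "E \<bullet> c = 0"
  shows "W = of_real (Re (W / c)) * c"
proof -
  have "Re E * (Im W * Re c - Re W * Im c) = 0" "Im E * (Im W * Re c - Re W * Im c) = 0"
    using assms(3,4) unfolding inner_complex_def by algebra+
  then have "Im W * Re c - Re W * Im c = 0"
    using assms(1) by (auto simp: complex_eq_iff)
  then have "Im (W / c) = 0" by (simp add: Im_divide)
  then have "W / c = of_real (Re (W / c))" by (simp add: complex_eq_iff)
  then show ?thesis using assms(2) by (metis nonzero_eq_divide_eq)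
qed

lemma geodesic_arc_cball:
  assumes "geodesic_arc g a b"
  shows "path_image g \<subseteq> cball 0 1"
proof -
  obtain l where "geodesic_line l" "path_image g \<subseteq> closure l"
    using assms unfolding geodesic_arc_def by blast
  then show ?thesis using geodesic_line_equation[of l] by blast
qed

text \<open>This is uniqueness of the geodesic arc. \<open>mob p\<close> carries the arc into the
  diameter through \<open>c\<close>, with real coordinate \<open>f\<close>. Being continuous and
  injective with \<open>f 0 = 0\<close> and \<open>f 1 = 1\<close>, \<open>f\<close> is monotone, so
  the arc neither starts backwards nor overshoots \<open>a\<close>.\<close>

lemma geodesic_arc_image:
  assumes p: "norm p < 1" "a \<noteq> p" and g: "geodesic_arc g p a" and z: "z \<in> path_image g"
  shows "\<exists>t\<in>{0..1}. mob p z = of_real t * mob p a"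
proof -
  have cb: "path_image g \<subseteq> cball 0 1" using geodesic_arc_cball[OF g] .
  have arc: "continuous_on {0..1} g" "inj_on g {0..1}" "g 0 = p" "g 1 = a"
    using g by (auto simp: geodesic_arc_def arc_def path_def pathstart_def pathfinish_def)
  have gcb: "norm (g s) \<le> 1" if "s \<in> {0..1}" for s
    using cb that by (force simp: path_image_def)
  have a: "norm a \<le> 1" using gcb[of 1] arc by simp
  define c where "c = mob p a"
  have c: "c \<noteq> 0" using mob_eq_0_iff p a by (simp add: c_def)
  obtain l where l: "geodesic_line l" "path_image g \<subseteq> closure l"
    using g unfolding geodesic_arc_def by blast
  obtain A :: real and B where AB: "\<bar>A\<bar> < norm B"
    and "closure l \<subseteq> {z \<in> cball 0 1. A * (1 + (norm z)\<^sup>2) = 2 * (B \<bullet> z)}"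
    using geodesic_line_equation[OF l(1)] .
  then have eq: "A * (1 + (norm (g s))\<^sup>2) = 2 * (B \<bullet> g s)" if "s \<in> {0..1}" for s
    using l(2) that unfolding path_image_def by blast
  define E where "E = B + cnj B * p\<^sup>2 - 2 * of_real A * p"
  have peq: "A * (1 + (norm p)\<^sup>2) = 2 * (B \<bullet> p)" using eq[of 0] arc by simp
  have E0: "E \<noteq> 0" using mob_geodesic_collinear(1)[OF AB p(1) peq E_def] .
  have Ez: "E \<bullet> mob p (g s) = 0" if "s \<in> {0..1}" for s
    using mob_geodesic_collinear(2)[OF AB p(1) peq E_def gcb eq] that by simp
  define f where "f s = Re (mob p (g s) / c)" for s
  have f: "mob p (g s) = of_real (f s) * c" if "s \<in> {0..1}" for s
    unfolding f_def using inner_eq_0_collinear[OF E0 c Ez[OF that]] Ez[of 1] arc c_def by simp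
  have f01: "f 0 = 0" "f 1 = 1" using c arc by (auto simp: f_def c_def)
  have contf: "continuous_on {0..1} f"
    unfolding f_def using c gcb p(1) arc(1)
    by (intro continuous_intros continuous_on_compose2[OF continuous_on_mob]) auto
  have injf: "inj_on f {0..1}"
  proof (rule inj_onI)
    fix s t assume st: "s \<in> {0..1}" "t \<in> {0..1}" "f s = f t"
    then have "mob (- p) (mob p (g s)) = mob (- p) (mob p (g t))" using f by simp
    then have "g s = g t"
      unfolding mob_mob_uminus(1)[OF p(1) gcb[OF st(1)]] mob_mob_uminus(1)[OF p(1) gcb[OF st(2)]] .
    then show "s = t" using arc(2) st(1,2) by (simp add: inj_on_eq_iff)
  qed
  obtain s where s: "s \<in> {0..1}" "z = g s" using z by (auto simp: path_image_def)
  have "f s \<in> {0..1}"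
  proof (cases "s = 0 \<or> s = 1")
    case False
    then show ?thesis
      using continuous_inj_imp_mono[OF _ _ contf injf, of s] s f01 by auto
  qed (use f01 in auto)
  then show ?thesis using f s c_def by auto
qed

lemma hyp_J_eq:
  assumes "norm p < 1" "norm a \<le> 1" "a \<noteq> p"
  shows "hyp_J p a = {z \<in> unit_disk. \<exists>t\<in>{0..1}. mob p z = of_real t * mob p a}"
proof (intro equalityI subsetI)
  fix z assume "z \<in> hyp_J p a"
  then show "z \<in> {z \<in> unit_disk. \<exists>t\<in>{0..1}. mob p z = of_real t * mob p a}"
    using geodesic_arc_image[OF assms(1,3)] unfolding hyp_J_def by blast
next
  fix z assume "z \<in> {z \<in> unit_disk. \<exists>t\<in>{0..1}. mob p z = of_real t * mob p a}"
  then obtain t where t: "norm z < 1" "t \<in> {0..1}" "mob p z = of_real t * mob p a" by auto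
  have "z = mob (- p) (of_real t * mob p a)"
    using mob_mob_uminus(1)[of p z] t assms by simp
  then have "z \<in> path_image (\<lambda>t. mob (- p) (of_real t * mob p a))"
    using t(2) by (auto simp: path_image_def)
  then show "z \<in> hyp_J p a"
    unfolding hyp_J_def using geodesic_arc_radius[OF assms] t(1) by auto
qed

section \<open>Directions and angles\<close>

lemma filterlim_neq_bot:
  assumes "filterlim f F G" "G \<noteq> bot"
  shows "F \<noteq> bot"
  using assms filtermap_bot_iff[of f G] unfolding filterlim_def by (metis le_bot)

text \<open>On the geodesic \<open>z - p = (1 - cnj p * z) * (t * c)\<close> with
  \<open>t > 0\<close>, so \<open>sgn (z - p)\<close> is \<open>sgn (1 - cnj p * z) * sgn c\<close>,
  and the first factor tends to the sign of the positive number
  \<open>1 - (norm p)\<^sup>2\<close>.\<close>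

lemma geodesic_dir_eq:
  assumes "norm p < 1" "norm a \<le> 1" "a \<noteq> p"
  shows "geodesic_dir p a = sgn (mob p a)"
proof -
  define c where "c = mob p a"
  have c: "c \<noteq> 0" "norm c \<le> 1"
    using assms mob_eq_0_iff norm_mob_le_1 by (auto simp: c_def)
  have J: "hyp_J p a = {z \<in> unit_disk. \<exists>t\<in>{0..1}. mob p z = of_real t * c}"
    unfolding c_def by (rule hyp_J_eq[OF assms])
  have "filterlim (\<lambda>t. mob (- p) (of_real t * c)) (at p within hyp_J p a) (at_right 0)"
    unfolding filterlim_at
  proof
    have "isCont (mob (- p)) 0"
      unfolding Moebius_function_simple by (intro continuous_intros) auto
    then have "mob (- p) \<midarrow>0\<rightarrow> p"
      by (simp add: isCont_def Moebius_function_simple)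
    moreover have "filterlim (\<lambda>t. of_real t * c) (at 0) (at_right 0)"
      unfolding filterlim_at
    proof
      show "((\<lambda>t. of_real t * c) \<longlongrightarrow> 0) (at_right 0)"
        by (rule tendsto_eq_intros refl | simp)+
      show "\<forall>\<^sub>F t in at_right 0. of_real t * c \<in> UNIV \<and> of_real t * c \<noteq> 0"
        using c by (auto simp: eventually_at_filter)
    qed
    ultimately show "((\<lambda>t. mob (- p) (of_real t * c)) \<longlongrightarrow> p) (at_right 0)"
      by (rule filterlim_compose)
    show "\<forall>\<^sub>F t in at_right 0. mob (- p) (of_real t * c) \<in> hyp_J p a \<and> mob (- p) (of_real t * c) \<noteq> p"
      using eventually_at_right_real[of 0 1, OF zero_less_one]
    proof eventually_elim
      case (elim t)
      then have "norm (of_real t * c) \<le> t" using c by (simp add: norm_mult mult_left_le)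
      then have tc: "norm (of_real t * c) < 1" using elim by simp
      then have inv: "mob p (mob (- p) (of_real t * c)) = of_real t * c"
        using mob_mob_uminus(2) assms by simp
      have "norm (mob (- p) (of_real t * c)) < 1"
        using norm_mob_less_1[of "- p"] tc assms by simp
      moreover have "mob (- p) (of_real t * c) \<noteq> p"
        using inv elim c by auto
      ultimately show ?case unfolding J using inv elim by auto
    qed
  qed
  \<comment> \<open>\<open>Lim\<close> determines a direction only if \<open>p\<close> is an
    accumulation point of \<open>hyp_J p a\<close>; the parametrised radius witnesses this.\<close>
  then have nontrivial: "at p within hyp_J p a \<noteq> bot"
    by (rule filterlim_neq_bot) simp
  have "((\<lambda>z. sgn (1 - cnj p * z) * sgn c) \<longlongrightarrow> sgn (1 - cnj p * p) * sgn c) (at p within hyp_J p a)"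
    using one_minus_cnj_mult_neq_0[of p p] assms by (intro tendsto_intros) auto
  moreover have "sgn (1 - cnj p * p) = 1"
  proof -
    have "1 - cnj p * p = of_real (1 - (norm p)\<^sup>2)"
      by (simp only: of_real_diff complex_norm_square mult.commute of_real_1)
    moreover have "(norm p)\<^sup>2 < 1" using assms by (simp add: abs_square_less_1)
    ultimately show ?thesis by (simp only: sgn_of_real) simp
  qed
  moreover have "\<forall>\<^sub>F z in at p within hyp_J p a. sgn (1 - cnj p * z) * sgn c = sgn (z - p)"
    unfolding eventually_at_filter
  proof (intro always_eventually allI impI)
    fix z assume z: "z \<noteq> p" "z \<in> hyp_J p a"
    then obtain t where t: "norm z < 1" "t \<in> {0..1}" "mob p z = of_real t * c" by (auto simp: J)
    have n: "1 - cnj p * z \<noteq> 0" using one_minus_cnj_mult_neq_0[of p z] assms t by simp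
    have "mob p z \<noteq> 0" using mob_eq_0_iff[of p z] assms t z by simp
    then have "t > 0" using t by (cases "t = 0") auto
    moreover have "z - p = (1 - cnj p * z) * (of_real t * c)"
      using n by (simp add: t(3)[symmetric] Moebius_function_simple)
    ultimately show "sgn (1 - cnj p * z) * sgn c = sgn (z - p)"
      by (simp add: sgn_mult sgn_of_real)
  qed
  ultimately have "((\<lambda>z. sgn (z - p)) \<longlongrightarrow> sgn c) (at p within hyp_J p a)"
    using Lim_transform_eventually by fastforce
  then show ?thesis
    unfolding geodesic_dir_def c_def by (intro tendsto_Lim nontrivial)
qed

text \<open>In the frame \<open>p\<close>, \<open>\<i> * p\<close> at \<open>p\<close> the coordinates \<open>x\<close>, \<open>y\<close> of a point of a geodesic through \<open>p\<close> and
  \<open>a\<close> satisfy \<open>y = k (x\<^sup>2 + y\<^sup>2)\<close> with \<open>k\<close> depending only on \<open>a\<close>. So all arcs entering the definition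
  of \<^const>\<open>hyp_J\<close> are tangent to the radius at \<open>p\<close>, at the same rate.\<close>

lemma geodesic_dir_boundary:
  assumes p: "norm p = 1" and g: "geodesic_arc g p a"
  shows "geodesic_dir p a = - p"
proof -
  define y where "y z = (\<i> * p) \<bullet> (z - p)" for z
  define x where "x z = p \<bullet> (z - p)" for z
  define k where "k = y a / (norm (a - p))\<^sup>2"
  have z_eq: "z - p = p * Complex (x z) (y z)" for z
  proof -
    have "p * Complex (x z) (y z) = (p * cnj p) * (z - p)"
      by (simp add: complex_eq_iff x_def y_def inner_complex_def algebra_simps)
    moreover have "p * cnj p = 1" using p complex_norm_square[of p] by simp
    ultimately show ?thesis by simp
  qed
  have xy: "(x z)\<^sup>2 + (y z)\<^sup>2 = (norm (z - p))\<^sup>2" for z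
    unfolding z_eq[of z] using p by (simp add: norm_mult cmod_power2)
  have norm_z: "(norm z)\<^sup>2 = 1 + 2 * x z + (norm (z - p))\<^sup>2" for z
  proof -
    have "(norm (z - p))\<^sup>2 = (norm z)\<^sup>2 + (norm p)\<^sup>2 - 2 * (p \<bullet> z)"
      unfolding power2_norm_eq_inner by (simp add: inner_diff_left inner_diff_right inner_commute)
    then show ?thesis using p by (simp add: x_def inner_diff_right dot_square_norm)
  qed
  have yk: "y z = k * (norm (z - p))\<^sup>2" if "geodesic_arc h p a" "z \<in> path_image h" for h z
  proof -
    obtain l where l: "geodesic_line l" "path_image h \<subseteq> closure l"
      using \<open>geodesic_arc h p a\<close> unfolding geodesic_arc_def by blast
    obtain A :: real and B where AB: "\<bar>A\<bar> < norm B"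
      and "closure l \<subseteq> {z \<in> cball 0 1. A * (1 + (norm z)\<^sup>2) = 2 * (B \<bullet> z)}"
      using geodesic_line_equation[OF l(1)] .
    then have eq: "A * (1 + (norm z)\<^sup>2) = 2 * (B \<bullet> z)" if "z \<in> path_image h" for z
      using l(2) that by auto
    have "p \<in> path_image h" "a \<in> path_image h" "a \<noteq> p"
      using \<open>geodesic_arc h p a\<close> by (auto simp: geodesic_arc_def dest: arc_distinct_ends)
    have Bp: "B \<bullet> p = A" using eq[OF \<open>p \<in> _\<close>] p by simp
    \<comment> \<open>\<open>A\<close> and \<open>s\<close> are the components of \<open>B\<close>
      along \<open>p\<close> and \<open>\<i> * p\<close>, so \<open>\<bar>A\<bar> < norm B\<close>
      forces \<open>s\<close> to be nonzero, and the equation can be solved for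
      \<open>y\<close>.\<close>
    define s where "s = B \<bullet> (\<i> * p)"
    have "(norm B)\<^sup>2 = (norm B)\<^sup>2 * (norm p)\<^sup>2" using p by simp
    also have "\<dots> = A\<^sup>2 + s\<^sup>2"
      unfolding s_def Bp[symmetric]
      by (simp add: cmod_power2 inner_complex_def) (simp add: power2_eq_square algebra_simps)
    finally have "s\<^sup>2 = (norm B)\<^sup>2 - \<bar>A\<bar>\<^sup>2" by simp
    then have "s\<^sup>2 \<noteq> 0" using AB abs_le_square_iff[of "norm B" A] by auto
    then have s: "s \<noteq> 0" by simp
    have sy: "2 * s * y z = A * (norm (z - p))\<^sup>2" if "z \<in> path_image h" for z
    proof -
      have "B \<bullet> z = B \<bullet> p + B \<bullet> (z - p)" by (simp add: inner_diff_right)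
      also have "B \<bullet> (z - p) = A * x z + s * y z"
        unfolding z_eq[of z] s_def Bp[symmetric] by (simp add: inner_complex_def algebra_simps)
      finally show ?thesis using eq[OF that] Bp norm_z[of z] by (simp add: algebra_simps)
    qed
    have "2 * s * (y z * (norm (a - p))\<^sup>2) = 2 * s * (y a * (norm (z - p))\<^sup>2)"
      using sy[OF \<open>z \<in> _\<close>] sy[OF \<open>a \<in> _\<close>] by algebra
    then have "y z * (norm (a - p))\<^sup>2 = y a * (norm (z - p))\<^sup>2" using s by simp
    then show ?thesis using \<open>a \<noteq> p\<close> by (simp add: k_def field_simps)
  qed
  have arc: "continuous_on {0..1} g" "inj_on g {0..1}" "g 0 = p"
    using g by (auto simp: geodesic_arc_def arc_def path_def pathstart_def pathfinish_def)
  have lim_g: "(g \<longlongrightarrow> p) (at_right 0)"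
    using arc continuous_on_Icc_at_rightD[of 0 1 g] by simp
  have "filterlim g (at p within hyp_J p a) (at_right 0)"
    unfolding filterlim_at
  proof
    show "(g \<longlongrightarrow> p) (at_right 0)" by fact
    have "((\<lambda>t. (norm (g t - p))) \<longlongrightarrow> 0) (at_right 0)"
      using lim_g by (simp add: LIM_zero_iff tendsto_norm_zero)
    \<comment> \<open>On the unit circle \<open>x\<^sup>2 + y\<^sup>2 = - 2 * x\<close>; together
      with \<open>y = k * (x\<^sup>2 + y\<^sup>2)\<close> this leaves \<open>p\<close> itself and
      the point with \<open>x = - 2 / (1 + 4 * k\<^sup>2)\<close>. Closer to \<open>p\<close> than
      this bound the arc stays in the open disk.\<close>
    moreover have "0 < 2 / (1 + 4 * k\<^sup>2)" by (simp add: add_pos_nonneg)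
    ultimately have "\<forall>\<^sub>F t in at_right 0. norm (g t - p) < 2 / (1 + 4 * k\<^sup>2)"
      by (rule order_tendstoD)
    then show "\<forall>\<^sub>F t in at_right 0. g t \<in> hyp_J p a \<and> g t \<noteq> p"
      using eventually_at_right_real[of 0 1, OF zero_less_one]
    proof eventually_elim
      case (elim t)
      then have t: "t \<in> {0..1}" "g t \<in> path_image g" by (auto simp: path_image_def)
      have ne: "g t \<noteq> p" using arc elim inj_onD[of g "{0..1}" t 0] by auto
      moreover have "norm (g t) < 1"
      proof (rule ccontr)
        assume "\<not> norm (g t) < 1"
        moreover have "norm (g t) \<le> 1" using geodesic_arc_cball[OF g] t(2) by auto
        ultimately have "norm (g t) = 1" by simp
        then have 1: "(norm (g t - p))\<^sup>2 = - 2 * x (g t)" using norm_z[of "g t"] by simp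
        then have 2: "y (g t) = - 2 * k * x (g t)" using yk[OF g t(2)] by simp
        have "(x (g t)) * (x (g t) * (1 + 4 * k\<^sup>2) + 2) = 0"
          using xy[of "g t"] 1 2 by algebra
        moreover have "x (g t) \<noteq> 0" using 1 ne by auto
        ultimately have "x (g t) * (1 + 4 * k\<^sup>2) = - 2" by simp
        moreover have K: "1 + 4 * k\<^sup>2 > 0" by (simp add: add_pos_nonneg)
        ultimately have "x (g t) = - 2 / (1 + 4 * k\<^sup>2)"
          by (metis less_irrefl nonzero_eq_divide_eq)
        then have "\<bar>x (g t)\<bar> = 2 / (1 + 4 * k\<^sup>2)" using K by simp
        moreover have "\<bar>x (g t)\<bar> \<le> norm (g t - p)"
          unfolding x_def using Cauchy_Schwarz_ineq2[of p "g t - p"] p by simp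
        ultimately show False using elim by simp
      qed
      ultimately show ?case unfolding hyp_J_def using g t(2) by auto
    qed
  qed
  then have nontrivial: "at p within hyp_J p a \<noteq> bot"
    by (rule filterlim_neq_bot) simp
  let ?F = "at p within hyp_J p a"
  have "((\<lambda>z. k * norm (z - p)) \<longlongrightarrow> k * norm (p - p)) ?F"
    by (intro tendsto_intros)
  then have 0: "((\<lambda>z. k * norm (z - p)) \<longlongrightarrow> 0) ?F" by simp
  \<comment> \<open>This is \<open>sgn (z - p)\<close> in the frame \<open>p\<close>,
    \<open>\<i> * p\<close>. The second coordinate \<open>y / norm (z - p)\<close> equals
    \<open>k * norm (z - p)\<close> and vanishes in the limit; the first is negative because
    \<open>x < 0\<close> inside the disk.\<close>
  have "((\<lambda>z. p * Complex (- sqrt (1 - (k * norm (z - p))\<^sup>2)) (k * norm (z - p)))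
      \<longlongrightarrow> p * Complex (- sqrt (1 - 0\<^sup>2)) 0) ?F"
    by (intro tendsto_intros 0)
  moreover have "\<forall>\<^sub>F z in ?F. p * Complex (- sqrt (1 - (k * norm (z - p))\<^sup>2)) (k * norm (z - p)) = sgn (z - p)"
    unfolding eventually_at_filter
  proof (intro always_eventually allI impI)
    fix z assume z: "z \<noteq> p" "z \<in> hyp_J p a"
    then have y: "y z = k * (norm (z - p))\<^sup>2" and "norm z < 1"
      using yk unfolding hyp_J_def by auto
    have n: "norm (z - p) > 0" using z by simp
    have "(norm z)\<^sup>2 < 1" using \<open>norm z < 1\<close> by (simp add: abs_square_less_1)
    then have x: "x z < 0" using norm_z[of z] zero_le_power2[of "norm (z - p)"] by linarith
    have yn: "y z / norm (z - p) = k * norm (z - p)"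
      using y n by (simp add: power2_eq_square)
    have "(x z / norm (z - p))\<^sup>2 + (y z / norm (z - p))\<^sup>2 = 1"
      using xy[of z] n by (simp add: power_divide add_divide_distrib[symmetric])
    then have "1 - (k * norm (z - p))\<^sup>2 = (x z / norm (z - p))\<^sup>2"
      unfolding yn by simp
    then have "sqrt (1 - (k * norm (z - p))\<^sup>2) = - (x z / norm (z - p))"
      using x n by (simp add: divide_neg_pos)
    then have "p * Complex (- sqrt (1 - (k * norm (z - p))\<^sup>2)) (k * norm (z - p))
      = p * Complex (x z / norm (z - p)) (y z / norm (z - p))"
      unfolding yn by simp
    also have "\<dots> = sgn (z - p)"
    proof -
      have "Complex (x z / norm (z - p)) (y z / norm (z - p)) = Complex (x z) (y z) / of_real (norm (z - p))"
        by (simp add: complex_eq_iff)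
      then show ?thesis using z_eq[of z] by (simp add: sgn_eq)
    qed
    finally show "p * Complex (- sqrt (1 - (k * norm (z - p))\<^sup>2)) (k * norm (z - p)) = sgn (z - p)" .
  qed
  ultimately have "((\<lambda>z. sgn (z - p)) \<longlongrightarrow> p * Complex (- sqrt (1 - 0\<^sup>2)) 0) ?F"
    by (rule Lim_transform_eventually)
  moreover have "p * Complex (- sqrt (1 - 0\<^sup>2)) 0 = - p" by (simp add: complex_eq_iff)
  ultimately show ?thesis
    unfolding geodesic_dir_def using tendsto_Lim[OF nontrivial] by simp
qed

text \<open>Both directions equal \<open>- p\<close>, so their quotient is 1. Consequently a vertex
  with a right angle cannot lie on the unit circle.\<close>

lemma ccw_angle_boundary:
  assumes "norm p = 1" "geodesic_arc g p a" "geodesic_arc h p b"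
  shows "ccw_angle p a b = 0"
proof -
  have "p \<noteq> 0" using assms(1) by auto
  then show ?thesis
    unfolding ccw_angle_def using geodesic_dir_boundary assms by (simp add: Arg2pi_eq_0)
qed

text \<open>Replacing directions by the points \<open>mob p a\<close> and \<open>mob p b\<close>
  changes the quotient by a positive real factor, to which \<open>Arg2pi\<close> is blind.\<close>

lemma ccw_angle_eq:
  assumes "norm p < 1" "norm a \<le> 1" "a \<noteq> p" "norm b \<le> 1" "b \<noteq> p"
  shows "ccw_angle p a b = Arg2pi (mob p b / mob p a)"
proof -
  have "mob p a \<noteq> 0" "mob p b \<noteq> 0" using assms mob_eq_0_iff by auto
  then have "mob p b / mob p a \<noteq> 0"
    and "sgn (mob p b) / sgn (mob p a)
      = of_real (norm (mob p a) / norm (mob p b)) * (mob p b / mob p a)"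
    by (auto simp: sgn_eq)
  moreover have "0 < norm (mob p a) / norm (mob p b)"
    using \<open>mob p a \<noteq> 0\<close> \<open>mob p b \<noteq> 0\<close> by simp
  ultimately show ?thesis
    unfolding ccw_angle_def geodesic_dir_eq[OF assms(1-3)] geodesic_dir_eq[OF assms(1,4,5)]
    by (metis Arg2pi_times_of_real)
qed

lemma Arg2pi_eq_pi_half:
  assumes "Arg2pi z = pi / 2"
  shows "z = \<i> * of_real (norm z)"
  using Arg2pi_eq[of z] assms by (simp add: exp_eq_polar mult.commute)

lemma geodesic_arc_reverse:
  assumes "geodesic_arc g a b"
  shows "geodesic_arc (reversepath g) b a"
  using assms by (auto simp: geodesic_arc_def arc_reversepath)

lemma hyp_J_commute: "hyp_J a b = hyp_J b a"
proof -
  have "hyp_J a b \<subseteq> hyp_J b a" for a b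
    unfolding hyp_J_def using geodesic_arc_reverse path_image_reversepath by blast
  then show ?thesis by blast
qed

section \<open>Distances between perpendicular geodesics\<close>

text \<open>Seen from \<open>X\<close>, the right angle makes \<open>mob X Z\<close> an imaginary
  multiple of \<open>mob X 0 = - X\<close>, so \<open>cnj X * mob X Z\<close> has real part 0;
  clearing the denominator gives the equation. Since \<open>k\<close> is any real number, it holds
  for all points of the side and for both orientations.\<close>

lemma orthogonal_side_equation:
  assumes "norm a < 1" "norm b < 1" "norm z \<le> 1"
    and k: "mob b z = \<i> * of_real k * mob b a"
    and X: "X = mob a b" and Z: "Z = mob a z"
  shows "(1 + (norm X)\<^sup>2) * (X \<bullet> Z) = (norm X)\<^sup>2 * (1 + (norm Z)\<^sup>2)"
proof -
  have X1: "norm X < 1" "norm Z \<le> 1"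
    using assms norm_mob_less_1 norm_mob_le_1 by (auto simp: X Z)
  then have n: "1 - cnj X * Z \<noteq> 0" by (rule one_minus_cnj_mult_neq_0)
  have "mob X Z = \<i> * of_real k * mob X 0"
    using mob_conjugate[of a b z] mob_conjugate[of a b a] assms by (simp add: X Z)
  then have "(Z - X) / (1 - cnj X * Z) = - \<i> * of_real k * X"
    by (simp add: Moebius_function_simple)
  then have "Z - X = - \<i> * of_real k * X * (1 - cnj X * Z)"
    using n by (simp add: field_simps)
  then have "cnj X * (Z - X) * cnj (1 - cnj X * Z)
      = - \<i> * of_real k * (X * cnj X) * ((1 - cnj X * Z) * cnj (1 - cnj X * Z))"
    by (simp only: mult_ac)
  also have "\<dots> = \<i> * of_real (- k * (norm X)\<^sup>2 * (norm (1 - cnj X * Z))\<^sup>2)"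
    by (simp only: complex_norm_square of_real_mult of_real_minus mult_ac) simp
  finally have "Re (cnj X * (Z - X) * cnj (1 - cnj X * Z)) = 0"
    by simp
  moreover have "Re (cnj X * (Z - X) * cnj (1 - cnj X * Z))
      = (1 + (norm X)\<^sup>2) * (X \<bullet> Z) - (norm X)\<^sup>2 * (1 + (norm Z)\<^sup>2)"
    by (simp add: inner_complex_def cmod_power2) (simp add: power2_eq_square algebra_simps)
  ultimately show ?thesis by simp
qed

text \<open>\<open>Z\<close> lies on the geodesic through \<open>0\<close> perpendicular to \<open>X\<close>, and \<open>Z'\<close> on the geodesic through \<open>X\<close>
  perpendicular to the diameter through \<open>X\<close>.\<close>

lemma norm_mob_common_perpendicular:
  fixes X Z Z' :: complex
  assumes "norm X < 1" "norm Z < 1" "norm Z' < 1" and ZX: "Z \<bullet> X = 0"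
    and Z': "(1 + (norm X)\<^sup>2) * (X \<bullet> Z') = (norm X)\<^sup>2 * (1 + (norm Z')\<^sup>2)"
  shows "norm X \<le> norm (mob Z Z')"
proof (cases "X = 0")
  case False
  define x N e r where "x = (norm X)\<^sup>2" and "N = (norm Z')\<^sup>2" and "e = (norm Z)\<^sup>2" and "r = Z \<bullet> Z'"
  have bounds: "0 < x" "x < 1" "0 \<le> N" "N < 1" "0 \<le> e" "e < 1"
    using assms False by (auto simp: x_def N_def e_def abs_square_less_1)
  \<comment> \<open>The Gram determinant of the three plane vectors \<open>X\<close>,
    \<open>Z\<close>, \<open>Z'\<close> vanishes. For \<open>Z\<close> orthogonal to
    \<open>X\<close> this is Pythagoras for \<open>Z'\<close>, multiplied by \<open>e * x\<close> so
    that \<open>Z = 0\<close> is included.\<close>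
  have "(r\<^sup>2 * x + (X \<bullet> Z')\<^sup>2 * e) - e * N * x = (Z \<bullet> X) * (2 * r * (X \<bullet> Z') - (Z \<bullet> X) * N)"
    unfolding x_def N_def e_def r_def
    by (simp add: inner_complex_def cmod_power2) (simp add: power2_eq_square algebra_simps)
  then have 1: "r\<^sup>2 * x + (X \<bullet> Z')\<^sup>2 * e = e * N * x" using ZX by simp
  have 2: "(1 + x) * (X \<bullet> Z') = x * (1 + N)" using Z' by (simp add: x_def N_def)
  have "x * ((1 + x)\<^sup>2 * r\<^sup>2) = x * (e * ((N - x) * (1 - x * N)))"
    using 1 2 by algebra
  then have r2: "(1 + x)\<^sup>2 * r\<^sup>2 = e * ((N - x) * (1 - x * N))" using bounds by simp
  have xN: "x * N < 1" using bounds mult_strict_mono[of x 1 N 1] by simp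
  \<comment> \<open>Among the points of its perpendicular, \<open>X\<close> is nearest to 0; this
    follows from Cauchy-Schwarz applied to \<open>X \<bullet> Z'\<close>.\<close>
  have "N \<ge> x"
  proof -
    have "(X \<bullet> Z')\<^sup>2 \<le> x * N"
      using Cauchy_Schwarz_ineq[of X Z'] by (simp add: x_def N_def dot_square_norm)
    then have "(x * (1 + N))\<^sup>2 \<le> (1 + x)\<^sup>2 * (x * N)"
      unfolding 2[symmetric] power_mult_distrib by (simp add: mult_left_mono)
    then have "0 \<le> x * ((1 + x)\<^sup>2 * N - x * (1 + N)\<^sup>2)"
      by (simp add: power2_eq_square algebra_simps)
    also have "(1 + x)\<^sup>2 * N - x * (1 + N)\<^sup>2 = (N - x) * (1 - x * N)" by algebra
    finally have "0 \<le> (N - x) * (1 - x * N)" using bounds by (simp add: zero_le_mult_iff)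
    then show ?thesis using xN by (simp add: zero_le_mult_iff)
  qed
  \<comment> \<open>The claim amounts to
    \<open>2 * r * (1 - x) \<le> (N - x) + e * (1 - x * N)\<close>. By the formula for
    \<open>r\<^sup>2\<close>, the left side with \<open>1 + x\<close> for \<open>1 - x\<close> is,
    up to sign, twice the geometric mean of the two summands on the right.\<close>
  have "(2 * r * (1 - x))\<^sup>2 \<le> (2 * r * (1 + x))\<^sup>2"
    using bounds by (simp add: power_mult_distrib mult_left_mono)
  also have "\<dots> = 4 * (e * ((N - x) * (1 - x * N)))"
    using r2 by algebra
  also have "\<dots> \<le> ((N - x) + e * (1 - x * N))\<^sup>2"
    using zero_le_power2[of "(N - x) - e * (1 - x * N)"] by (simp add: power2_eq_square algebra_simps)
  finally have "2 * r * (1 - x) \<le> (N - x) + e * (1 - x * N)"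
    by (rule power2_le_imp_le) (use bounds xN \<open>N \<ge> x\<close> in auto)
  then have "(1 - e) * (1 - N) \<le> (1 - x) * (1 - 2 * r + e * N)"
    by (simp add: algebra_simps)
  also have "1 - 2 * r + e * N = (norm (1 - cnj Z * Z'))\<^sup>2"
    unfolding N_def e_def r_def
    by (simp add: inner_complex_def cmod_power2) (simp add: power2_eq_square algebra_simps)
  finally have "(1 - e) * (1 - N) / (norm (1 - cnj Z * Z'))\<^sup>2 \<le> 1 - x"
    using one_minus_cnj_mult_neq_0[of Z Z'] assms by (simp add: divide_le_eq)
  then have "(norm X)\<^sup>2 \<le> (norm (mob Z Z'))\<^sup>2"
    using one_minus_norm_mob[of Z Z'] assms(2,3) unfolding x_def N_def e_def by linarith
  then show ?thesis by (rule power2_le_imp_le) simp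
qed simp

section \<open>Order and addition laws for \<open>artanh\<close>\<close>

lemma artanh_strict_mono:
  fixes x y :: real
  assumes "-1 < x" "x < y" "y < 1"
  shows "artanh x < artanh y"
proof -
  have "(1 + x) * (1 - y) < (1 + y) * (1 - x)"
    using assms by (simp add: algebra_simps)
  then have "(1 + x) / (1 - x) < (1 + y) / (1 - y)"
    using assms by (simp add: divide_simps)
  then show ?thesis using assms by (simp add: artanh_def)
qed

lemma artanh_less_iff:
  fixes x y :: real
  assumes "\<bar>x\<bar> < 1" "\<bar>y\<bar> < 1"
  shows "artanh x < artanh y \<longleftrightarrow> x < y" "artanh x \<le> artanh y \<longleftrightarrow> x \<le> y" "artanh x = artanh y \<longleftrightarrow> x = y"
proof -
  consider "x < y" | "x = y" | "y < x" by linarith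
  then show "artanh x < artanh y \<longleftrightarrow> x < y" "artanh x \<le> artanh y \<longleftrightarrow> x \<le> y" "artanh x = artanh y \<longleftrightarrow> x = y"
    using artanh_strict_mono[of x y] artanh_strict_mono[of y x] assms by (cases; force)+
qed

lemma artanh_add:
  fixes x y :: real
  assumes "\<bar>x\<bar> < 1" "\<bar>y\<bar> < 1"
  shows "artanh x + artanh y = artanh ((x + y) / (1 + x * y))"
proof -
  have "\<bar>x * y\<bar> < 1" using abs_mult_less[OF assms] by (simp add: abs_mult)
  then have xy: "1 + x * y > 0" by linarith
  have "1 + (x + y) / (1 + x * y) = (1 + x) * (1 + y) / (1 + x * y)"
    "1 - (x + y) / (1 + x * y) = (1 - x) * (1 - y) / (1 + x * y)"
    using xy by (simp_all add: field_simps)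
  then have "(1 + (x + y) / (1 + x * y)) / (1 - (x + y) / (1 + x * y))
      = (1 + x) / (1 - x) * ((1 + y) / (1 - y))"
    using xy by simp
  moreover have "(1 + x) / (1 - x) > 0" "(1 + y) / (1 - y) > 0"
    using assms by auto
  ultimately show ?thesis
    by (simp only: artanh_def ln_mult_pos add_divide_distrib)
qed

lemma tanh_double_artanh:
  fixes x :: real
  assumes "\<bar>x\<bar> < 1"
  shows "2 * artanh x = artanh (2 * x / (1 + x\<^sup>2))" "tanh (2 * artanh x) = 2 * x / (1 + x\<^sup>2)"
proof -
  show 1: "2 * artanh x = artanh (2 * x / (1 + x\<^sup>2))"
    using artanh_add[OF assms assms] by (simp add: power2_eq_square)
  have "\<bar>2 * x\<bar> < 1 + x\<^sup>2"
    using zero_less_power2[of "1 - \<bar>x\<bar>"] assms by (simp add: power2_eq_square algebra_simps)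
  then have "\<bar>2 * x / (1 + x\<^sup>2)\<bar> < 1" by (simp add: abs_divide)
  then show "tanh (2 * artanh x) = 2 * x / (1 + x\<^sup>2)"
    unfolding 1 by (metis artanh_less_iff(3) artanh_tanh_real tanh_real_bounds abs_less_iff greaterThanLessThan_iff minus_less_iff)
qed

text \<open>The segment from \<open>a\<close> to \<open>b\<close> is perpendicular to both sides.
  After moving \<open>a\<close> to 0, \<open>norm_mob_common_perpendicular\<close> shows that no
  pair of points is closer than the feet \<open>a\<close> and \<open>b\<close>, so the infimum is a
  minimum. The signs of \<open>s\<close> and \<open>k\<close> are free, so that either pair of
  opposite sides of the quadrilateral is covered.\<close>

lemma hyp_setdist_common_perpendicular:
  assumes a: "norm a < 1" and b: "norm b < 1" "b \<noteq> a" and c: "norm c \<le> 1" "c \<noteq> b"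
    and d: "norm d \<le> 1" "d \<noteq> a"
    and s: "mob a d = \<i> * of_real s * mob a b" and k: "mob b c = \<i> * of_real k * mob b a"
  shows "hyp_setdist (hyp_J a d) (hyp_J b c) = hyp_dist a b"
  unfolding hyp_setdist_def
proof (rule cInf_eq_minimum)
  have "a \<in> hyp_J a d" "b \<in> hyp_J b c"
    using assms by (auto simp: hyp_J_eq intro!: bexI[of _ 0])
  then show "hyp_dist a b \<in> {hyp_dist x y |x y. x \<in> hyp_J a d \<and> y \<in> hyp_J b c}" by blast
next
  fix h assume "h \<in> {hyp_dist x y |x y. x \<in> hyp_J a d \<and> y \<in> hyp_J b c}"
  then obtain z z' where z: "z \<in> hyp_J a d" and z': "z' \<in> hyp_J b c" and h: "h = hyp_dist z z'"
    by blast
  obtain t where t: "norm z < 1" "mob a z = of_real t * mob a d"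
    using z hyp_J_eq[OF a d] by auto
  obtain t' where t': "norm z' < 1" "mob b z' = of_real t' * mob b c"
    using z' hyp_J_eq[OF b(1) c] by auto
  have "mob a z \<bullet> mob a b = 0"
    unfolding t(2) s by (simp add: inner_complex_def algebra_simps)
  moreover have "(1 + (norm (mob a b))\<^sup>2) * (mob a b \<bullet> mob a z') = (norm (mob a b))\<^sup>2 * (1 + (norm (mob a z'))\<^sup>2)"
    by (rule orthogonal_side_equation[OF a b(1), of z' "t' * k"]) (use t' k in auto)
  ultimately have "norm (mob a b) \<le> norm (mob (mob a z) (mob a z'))"
    using a b t t' by (intro norm_mob_common_perpendicular norm_mob_less_1)
  also have "\<dots> = norm (mob z z')"
    using a t t' by (intro norm_mob_conjugate) auto
  finally have le: "norm (mob a b) \<le> norm (mob z z')" .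
  have "norm (mob a b) < 1" "norm (mob z z') < 1"
    using a b t t' by (auto intro: norm_mob_less_1)
  then have "artanh (norm (mob a b)) \<le> artanh (norm (mob z z'))"
    using le by (subst artanh_less_iff) auto
  then show "hyp_dist a b \<le> h"
    using a b t t' by (simp add: h hyp_dist_eq_mob)
qed

section \<open>The extremal problem\<close>

text \<open>The value of \<open>tanh (d1 + d2)\<close> as a function of \<open>s = cos \<theta> + sin \<theta>\<close>.\<close>

definition tanh_depth_sum :: "real \<Rightarrow> real \<Rightarrow> real"
  where "tanh_depth_sum L s = 2 * L * s / (2 - L\<^sup>2 + L\<^sup>2 * s\<^sup>2)"

lemma tanh_depth_sum_denom_pos:
  assumes "0 < L" "L \<le> 1"
  shows "2 - L\<^sup>2 + L\<^sup>2 * s\<^sup>2 > (0::real)"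
proof -
  have "L\<^sup>2 \<le> 1" using assms by (simp add: power_le_one)
  moreover have "0 \<le> L\<^sup>2 * s\<^sup>2" by simp
  ultimately show ?thesis by linarith
qed

lemma tanh_depth_sum_sqrt2: "tanh_depth_sum L (sqrt 2) = 2 * sqrt 2 * L / (2 + L\<^sup>2)"
  by (simp add: tanh_depth_sum_def mult_ac)

lemma tanh_depth_sum_1: "tanh_depth_sum L 1 = L"
  by (simp add: tanh_depth_sum_def)

text \<open>The difference factors, so two values are compared through the sign of
  \<open>(t - s) * (2 - L\<^sup>2 - L\<^sup>2 * s * t)\<close>, without derivatives.\<close>

lemma tanh_depth_sum_diff:
  assumes "0 < L" "L \<le> 1"
  shows "tanh_depth_sum L t - tanh_depth_sum L s =
    2 * L * (t - s) * (2 - L\<^sup>2 - L\<^sup>2 * s * t) / ((2 - L\<^sup>2 + L\<^sup>2 * t\<^sup>2) * (2 - L\<^sup>2 + L\<^sup>2 * s\<^sup>2))"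
  using tanh_depth_sum_denom_pos[OF assms, of s] tanh_depth_sum_denom_pos[OF assms, of t]
  unfolding tanh_depth_sum_def by (simp add: divide_simps) algebra

lemma tanh_depth_sum_less_iff:
  assumes "0 < L" "L \<le> 1"
  shows "tanh_depth_sum L s < tanh_depth_sum L t \<longleftrightarrow> 0 < (t - s) * (2 - L\<^sup>2 - L\<^sup>2 * s * t)"
    and "tanh_depth_sum L s = tanh_depth_sum L t \<longleftrightarrow> (t - s) * (2 - L\<^sup>2 - L\<^sup>2 * s * t) = 0"
proof -
  define c where "c = 2 * L / ((2 - L\<^sup>2 + L\<^sup>2 * t\<^sup>2) * (2 - L\<^sup>2 + L\<^sup>2 * s\<^sup>2))"
  have "c > 0"
    using assms tanh_depth_sum_denom_pos[OF assms, of s] tanh_depth_sum_denom_pos[OF assms, of t] by (simp add: c_def)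
  moreover have "tanh_depth_sum L t - tanh_depth_sum L s = c * ((t - s) * (2 - L\<^sup>2 - L\<^sup>2 * s * t))"
    by (simp add: tanh_depth_sum_diff[OF assms] c_def)
  ultimately have "0 < tanh_depth_sum L t - tanh_depth_sum L s \<longleftrightarrow> 0 < (t - s) * (2 - L\<^sup>2 - L\<^sup>2 * s * t)"
    "tanh_depth_sum L t - tanh_depth_sum L s = 0 \<longleftrightarrow> (t - s) * (2 - L\<^sup>2 - L\<^sup>2 * s * t) = 0"
    by (simp_all only: zero_less_mult_iff mult_eq_0_iff) auto
  then show "tanh_depth_sum L s < tanh_depth_sum L t \<longleftrightarrow> 0 < (t - s) * (2 - L\<^sup>2 - L\<^sup>2 * s * t)"
    "tanh_depth_sum L s = tanh_depth_sum L t \<longleftrightarrow> (t - s) * (2 - L\<^sup>2 - L\<^sup>2 * s * t) = 0"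
    by linarith+
qed

text \<open>Denominator minus numerator is \<open>(1 - L * s)\<^sup>2 + (1 - L\<^sup>2)\<close>,
  which vanishes only for \<open>L = s = 1\<close>.\<close>

lemma tanh_depth_sum_less_1:
  assumes "0 < L" "L \<le> 1" "L < 1 \<or> s \<noteq> 1"
  shows "tanh_depth_sum L s < 1"
proof -
  have "0 < (1 - L * s)\<^sup>2 + (1 - L\<^sup>2)"
  proof (cases "L = 1")
    case False
    then have "L\<^sup>2 < 1" using assms by (simp add: abs_square_less_1)
    moreover have "0 \<le> (1 - L * s)\<^sup>2" by simp
    ultimately show ?thesis by linarith
  qed (use assms in auto)
  then have "2 * L * s < 2 - L\<^sup>2 + L\<^sup>2 * s\<^sup>2" by (simp add: power2_eq_square algebra_simps)
  then show ?thesis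
    unfolding tanh_depth_sum_def using tanh_depth_sum_denom_pos[of L s] assms by (simp add: divide_simps)
qed

text \<open>Here \<open>2 * p * q = (p + q)\<^sup>2 - 1\<close>. The identity serves both for the
  cosine and sine of the angle and for the extremal pair \<open>r0\<close>,
  \<open>r0'\<close>.\<close>

lemma tanh_depth_sum_cos_sin:
  fixes p q :: real
  assumes "p\<^sup>2 + q\<^sup>2 = 1"
  shows "tanh_depth_sum L (p + q) = L * (p + q) / (1 + L\<^sup>2 * p * q)"
proof -
  have "L * (p + q) / (1 + L\<^sup>2 * p * q) = 2 * (L * (p + q)) / (2 * (1 + L\<^sup>2 * p * q))"
    by (subst mult_divide_mult_cancel_left) auto
  also have "2 * (1 + L\<^sup>2 * p * q) = 2 - L\<^sup>2 + L\<^sup>2 * (p + q)\<^sup>2"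
    using assms by algebra
  finally show ?thesis by (simp add: tanh_depth_sum_def mult_ac)
qed

text \<open>With \<open>p = cos \<theta>\<close>, \<open>q = sin \<theta>\<close> and
  \<open>s = p + q\<close>, each claim compares \<open>s\<close> with a reference value
  \<open>t\<close>, which is 1, \<open>sqrt 2\<close> or \<open>r0 + r0'\<close>, through the sign
  of \<open>(s - t) * (2 - L\<^sup>2 - L\<^sup>2 * t * s)\<close>. The second factor vanishes at
  \<open>s = t = sqrt 2\<close> when \<open>L\<^sup>2 = 2 / 3\<close>, and at
  \<open>s = sqrt 2\<close>, \<open>t = 1\<close> when \<open>L\<^sup>2 = 2 * (sqrt 2 - 1)\<close>,
  where both ends of the range of \<open>s\<close> give the same value.\<close>

lemma lambert_depth_bounds:
  fixes p q L m r0 r0' d :: real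
  assumes pq: "0 < p" "0 < q" "p\<^sup>2 + q\<^sup>2 = 1"
    and L: "0 < L" "L \<le> 1"
    and d: "d = artanh (L * p) + artanh (L * q)"
    and m: "L > sqrt (2 / 3) \<Longrightarrow> m = sqrt ((2 - L\<^sup>2) * (3 * L\<^sup>2 - 2))"
    and r0: "L > sqrt (2 / 3) \<Longrightarrow> r0 = sqrt ((1 - m / L\<^sup>2) / 2)"
    and r0': "L > sqrt (2 / 3) \<Longrightarrow> r0' = sqrt (1 - r0\<^sup>2)"
  shows "L < 1 \<Longrightarrow> L < sqrt (2 * (sqrt 2 - 1)) \<Longrightarrow> artanh L < d"
    and "L \<le> sqrt (2 / 3) \<Longrightarrow> d \<le> artanh (2 * sqrt 2 * L / (2 + L\<^sup>2))"
    and "sqrt (2 * (sqrt 2 - 1)) \<le> L \<Longrightarrow> artanh (2 * sqrt 2 * L / (2 + L\<^sup>2)) \<le> d"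
    and "L \<le> sqrt (2 / 3) \<or> sqrt (2 * (sqrt 2 - 1)) \<le> L \<Longrightarrow>
      d = artanh (2 * sqrt 2 * L / (2 + L\<^sup>2)) \<longleftrightarrow> p = q"
    and "sqrt (2 / 3) < L \<Longrightarrow> L < 1 \<Longrightarrow> d \<le> artanh (L * (r0 + r0') / (1 + L\<^sup>2 * r0 * r0'))"
    and "sqrt (2 / 3) < L \<Longrightarrow> L < 1 \<Longrightarrow>
      d = artanh (L * (r0 + r0') / (1 + L\<^sup>2 * r0 * r0')) \<longleftrightarrow> p = r0 \<or> p = r0'"
    and "sqrt (2 / 3) < L \<Longrightarrow> L < 1 \<Longrightarrow> 0 \<le> r0 \<and> r0 \<le> 1 \<and> 0 \<le> r0' \<and> r0' \<le> 1"
proof -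
  define s where "s = p + q"
  have "0 < p * q" using pq by simp
  have s2: "s\<^sup>2 = 1 + 2 * (p * q)" using pq(3) unfolding s_def by algebra
  then have "1\<^sup>2 < s\<^sup>2" using \<open>0 < p * q\<close> by simp
  then have s1: "1 < s" by (rule power2_less_imp_less) (use pq in \<open>simp add: s_def\<close>)
  have "(sqrt 2)\<^sup>2 - s\<^sup>2 = (p - q)\<^sup>2" using pq(3) by (simp add: s_def power2_eq_square algebra_simps)
  then have "s\<^sup>2 \<le> (sqrt 2)\<^sup>2" "s\<^sup>2 = (sqrt 2)\<^sup>2 \<longleftrightarrow> (p - q)\<^sup>2 = 0"
    using zero_le_power2[of "p - q"] by linarith+
  moreover have "s\<^sup>2 = (sqrt 2)\<^sup>2 \<longleftrightarrow> s = sqrt 2"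
    using s1 by (intro power2_eq_iff_nonneg) auto
  ultimately have s_sqrt2: "s \<le> sqrt 2" "s = sqrt 2 \<longleftrightarrow> p = q"
    using power2_le_imp_le[of s "sqrt 2"] by auto
  have sqrt2: "1 < sqrt 2" "sqrt 2 < 2" by (auto simp: real_less_lsqrt)
  have "0 < p\<^sup>2" "0 < q\<^sup>2" using pq by auto
  then have "p\<^sup>2 < 1\<^sup>2" "q\<^sup>2 < 1\<^sup>2" using pq(3) unfolding power_one by linarith+
  then have "p < 1" "q < 1" by (auto intro: power2_less_imp_less)
  moreover have "L * p \<le> p" "L * q \<le> q" using L pq by (auto intro: mult_left_le_one_le)
  ultimately have "L * p < 1" "L * q < 1" by linarith+
  then have "d = artanh (L * (p + q) / (1 + L\<^sup>2 * p * q))"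
    unfolding d using artanh_add[of "L * p" "L * q"] pq L
    by (simp add: power2_eq_square algebra_simps)
  then have d_eq: "d = artanh (tanh_depth_sum L s)"
    unfolding s_def using tanh_depth_sum_cos_sin[OF pq(3)] by simp
  \<comment> \<open>For \<open>L = t = 1\<close> the value would be 1, outside the interval on which
    \<open>artanh\<close> is compared.\<close>
  have abs1: "\<bar>tanh_depth_sum L t\<bar> < 1" if "L < 1 \<or> t \<noteq> 1" "t > 0" for t
    using tanh_depth_sum_less_1[OF L that(1)] tanh_depth_sum_denom_pos[OF L, of t] that L
    by (simp add: tanh_depth_sum_def abs_of_pos)
  have L2: "0 < L\<^sup>2" "L\<^sup>2 \<le> 1" using L by (auto simp: power_le_one)
  have less: "artanh (tanh_depth_sum L t) < d \<longleftrightarrow> 0 < (s - t) * (2 - L\<^sup>2 - L\<^sup>2 * t * s)"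
    and le: "artanh (tanh_depth_sum L t) \<le> d \<longleftrightarrow> 0 \<le> (s - t) * (2 - L\<^sup>2 - L\<^sup>2 * t * s)"
    and ge: "d \<le> artanh (tanh_depth_sum L t) \<longleftrightarrow> (s - t) * (2 - L\<^sup>2 - L\<^sup>2 * t * s) \<le> 0"
    and eq: "d = artanh (tanh_depth_sum L t) \<longleftrightarrow> (s - t) * (2 - L\<^sup>2 - L\<^sup>2 * t * s) = 0"
    if "L < 1 \<or> t \<noteq> 1" "t > 0" for t
  proof -
    have "\<bar>tanh_depth_sum L t\<bar> < 1" "\<bar>tanh_depth_sum L s\<bar> < 1" using abs1 that s1 by auto
    then have "artanh (tanh_depth_sum L t) < d \<longleftrightarrow> tanh_depth_sum L t < tanh_depth_sum L s"
      "d = artanh (tanh_depth_sum L t) \<longleftrightarrow> tanh_depth_sum L t = tanh_depth_sum L s"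
      unfolding d_eq by (auto simp: artanh_less_iff)
    then show "artanh (tanh_depth_sum L t) < d \<longleftrightarrow> 0 < (s - t) * (2 - L\<^sup>2 - L\<^sup>2 * t * s)"
      "artanh (tanh_depth_sum L t) \<le> d \<longleftrightarrow> 0 \<le> (s - t) * (2 - L\<^sup>2 - L\<^sup>2 * t * s)"
      "d \<le> artanh (tanh_depth_sum L t) \<longleftrightarrow> (s - t) * (2 - L\<^sup>2 - L\<^sup>2 * t * s) \<le> 0"
      "d = artanh (tanh_depth_sum L t) \<longleftrightarrow> (s - t) * (2 - L\<^sup>2 - L\<^sup>2 * t * s) = 0"
      unfolding tanh_depth_sum_less_iff[OF L] by linarith+
  qed
  have sqrt_L: "sqrt (L\<^sup>2) = L" using L by simp
  have sq_le: "L\<^sup>2 \<le> c" if "L \<le> sqrt c" for c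
    using that real_sqrt_le_iff[of "L\<^sup>2" c] unfolding sqrt_L by blast
  have sq_less: "L\<^sup>2 < c" if "L < sqrt c" for c
    using that real_sqrt_less_iff[of "L\<^sup>2" c] unfolding sqrt_L by blast
  have sq_ge: "c \<le> L\<^sup>2" if "sqrt c \<le> L" for c
    using that real_sqrt_le_iff[of c "L\<^sup>2"] unfolding sqrt_L by blast
  have sq_greater: "c < L\<^sup>2" if "sqrt c < L" for c
    using that real_sqrt_less_iff[of c "L\<^sup>2"] unfolding sqrt_L by blast
  have fac: "2 * (sqrt 2 - 1) * (1 + sqrt 2) = 2" by (simp add: algebra_simps)
  show "artanh L < d" if "L < 1" "L < sqrt (2 * (sqrt 2 - 1))"
  proof -
    have "L\<^sup>2 < 2 * (sqrt 2 - 1)"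
      using sq_less that(2) .
    moreover have "0 < 1 + sqrt 2" using sqrt2 by linarith
    ultimately have "L\<^sup>2 * (1 + sqrt 2) < 2 * (sqrt 2 - 1) * (1 + sqrt 2)"
      by (rule mult_strict_right_mono)
    then have "L\<^sup>2 * (1 + sqrt 2) < 2" unfolding fac .
    moreover have "L\<^sup>2 * (1 + s) \<le> L\<^sup>2 * (1 + sqrt 2)" using L2 s_sqrt2 by (intro mult_left_mono) auto
    ultimately have "0 < 2 - L\<^sup>2 - L\<^sup>2 * 1 * s" by (simp add: algebra_simps)
    then have "artanh (tanh_depth_sum L 1) < d"
      using that s1 by (subst less) auto
    then show ?thesis by (simp add: tanh_depth_sum_1)
  qed
  have lo: "0 < 2 - L\<^sup>2 - L\<^sup>2 * sqrt 2 * s" if "L \<le> sqrt (2 / 3)" "s < sqrt 2"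
  proof -
    have "L\<^sup>2 \<le> 2 / 3" using sq_le that(1) .
    moreover have "L\<^sup>2 * sqrt 2 * s < L\<^sup>2 * sqrt 2 * sqrt 2"
      using L2 that by (intro mult_strict_left_mono) auto
    moreover have "L\<^sup>2 * sqrt 2 * sqrt 2 = 2 * L\<^sup>2" by simp
    ultimately show ?thesis by linarith
  qed
  have hi: "2 - L\<^sup>2 - L\<^sup>2 * sqrt 2 * s < 0" if "sqrt (2 * (sqrt 2 - 1)) \<le> L"
  proof -
    have "2 * (sqrt 2 - 1) \<le> L\<^sup>2" using sq_ge that .
    then have "2 * (sqrt 2 - 1) * (1 + sqrt 2) \<le> L\<^sup>2 * (1 + sqrt 2)"
      using sqrt2 by (intro mult_right_mono) auto
    moreover have "L\<^sup>2 * sqrt 2 * 1 < L\<^sup>2 * sqrt 2 * s" using L2 s1 by (intro mult_strict_left_mono) auto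
    moreover have "L\<^sup>2 * (1 + sqrt 2) = L\<^sup>2 + L\<^sup>2 * sqrt 2 * 1" by (simp add: algebra_simps)
    ultimately show ?thesis unfolding fac by linarith
  qed
  show "d \<le> artanh (2 * sqrt 2 * L / (2 + L\<^sup>2))" if "L \<le> sqrt (2 / 3)"
    using lo[OF that] s_sqrt2 unfolding tanh_depth_sum_sqrt2[symmetric]
    by (subst ge) (auto simp: mult_nonpos_nonneg order.order_iff_strict[of s])
  show "artanh (2 * sqrt 2 * L / (2 + L\<^sup>2)) \<le> d" if "sqrt (2 * (sqrt 2 - 1)) \<le> L"
    using hi[OF that] s_sqrt2 unfolding tanh_depth_sum_sqrt2[symmetric]
    by (subst le) (auto simp: mult_nonpos_nonpos)
  show "d = artanh (2 * sqrt 2 * L / (2 + L\<^sup>2)) \<longleftrightarrow> p = q"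
    if "L \<le> sqrt (2 / 3) \<or> sqrt (2 * (sqrt 2 - 1)) \<le> L"
    using lo hi that s_sqrt2 unfolding tanh_depth_sum_sqrt2[symmetric]
    by (subst eq) (auto simp: order.order_iff_strict[of s])
  {
    assume L': "sqrt (2 / 3) < L" "L < 1"
    have "L\<^sup>2 > 2 / 3"
      using sq_greater L'(1) .
    define M where "M = m / L\<^sup>2"
    have "m\<^sup>2 = (2 - L\<^sup>2) * (3 * L\<^sup>2 - 2)" "m \<ge> 0"
      using m[OF L'(1)] \<open>L\<^sup>2 > 2 / 3\<close> L2 by auto
    then have M: "M\<^sup>2 * (L\<^sup>2)\<^sup>2 = (2 - L\<^sup>2) * (3 * L\<^sup>2 - 2)" "M \<ge> 0"
      using L2 by (auto simp: M_def power_divide)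
    \<comment> \<open>Since \<open>r0\<^sup>2\<close> and \<open>r0'\<^sup>2\<close> are
      \<open>(1 - M) / 2\<close> and \<open>(1 + M) / 2\<close>, this says that
      \<open>L\<^sup>2 * r0 * r0'\<close> is \<open>1 - L\<^sup>2\<close>, hence
      \<open>L\<^sup>2 * S\<^sup>2 = 2 - L\<^sup>2\<close>: \<open>S\<close> is the maximum point of
      \<open>tanh_depth_sum L\<close> on the positive axis.\<close>
    then have M1: "(1 - M\<^sup>2) * (L\<^sup>2)\<^sup>2 = (2 * (1 - L\<^sup>2))\<^sup>2" by algebra
    then have "0 \<le> (1 - M\<^sup>2) * (L\<^sup>2)\<^sup>2" by simp
    then have "0 \<le> 1 - M\<^sup>2" using L2 by (simp add: zero_le_mult_iff)
    then have "M \<le> 1" using M(2) by (simp add: abs_square_le_1)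
    have r2: "r0\<^sup>2 = (1 - M) / 2" "0 \<le> r0" "r0'\<^sup>2 = (1 + M) / 2" "0 \<le> r0'"
      using r0[OF L'(1)] r0'[OF L'(1)] \<open>M \<le> 1\<close> M(2) by (auto simp: M_def[symmetric] field_simps)
    have "r0 \<le> 1" by (rule power2_le_imp_le) (use r2 M(2) in auto)
    moreover have "r0' \<le> 1" by (rule power2_le_imp_le) (use r2 \<open>M \<le> 1\<close> in auto)
    ultimately show "0 \<le> r0 \<and> r0 \<le> 1 \<and> 0 \<le> r0' \<and> r0' \<le> 1" using r2 by simp
    have sum1: "r0\<^sup>2 + r0'\<^sup>2 = 1" using r2 by (simp add: field_simps)
    define S where "S = r0 + r0'"
    have "(L\<^sup>2 * (r0 * r0'))\<^sup>2 = (1 - L\<^sup>2)\<^sup>2"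
      using M1 r2 by algebra
    then have rr: "L\<^sup>2 * (r0 * r0') = 1 - L\<^sup>2"
      by (rule power2_eq_imp_eq) (use r2 L2 in auto)
    have LS: "L\<^sup>2 * S\<^sup>2 = 2 - L\<^sup>2" using rr sum1 unfolding S_def by algebra
    have "S \<noteq> 0" using LS L2 by auto
    then have "S > 0" using r2 unfolding S_def by linarith
    \<comment> \<open>At the critical point the sign expression is minus a square times a positive
      factor, which gives the bound and its equality case at once.\<close>
    have Seq: "(s - S) * (2 - L\<^sup>2 - L\<^sup>2 * S * s) = - (L\<^sup>2 * S * (s - S)\<^sup>2)"
      unfolding LS[symmetric] by (simp add: power2_eq_square algebra_simps)
    have f: "tanh_depth_sum L S = L * (r0 + r0') / (1 + L\<^sup>2 * r0 * r0')"
      unfolding S_def using tanh_depth_sum_cos_sin[OF sum1] .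
    show "d \<le> artanh (L * (r0 + r0') / (1 + L\<^sup>2 * r0 * r0'))"
      unfolding f[symmetric] using L' \<open>S > 0\<close> by (subst ge) (auto simp: Seq)
    have "d = artanh (tanh_depth_sum L S) \<longleftrightarrow> s = S"
      using L' \<open>S > 0\<close> L2 by (subst eq) (auto simp: Seq)
    also have "s = S \<longleftrightarrow> p = r0 \<or> p = r0'"
    proof
      assume "s = S"
      \<comment> \<open>Equal sums and equal sums of squares give equal products, so
        \<open>p\<close> is a root of the quadratic with roots \<open>r0\<close> and
        \<open>r0'\<close>.\<close>
      then have "(p - r0) * (p - r0') = 0" using pq(3) sum1 unfolding s_def S_def by algebra
      then show "p = r0 \<or> p = r0'" by simp
    next
      assume "p = r0 \<or> p = r0'"
      then have "q\<^sup>2 = r0'\<^sup>2 \<and> p = r0 \<or> q\<^sup>2 = r0\<^sup>2 \<and> p = r0'" using pq(3) sum1 by auto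
      moreover have "q\<^sup>2 = r0'\<^sup>2 \<longleftrightarrow> q = r0'" "q\<^sup>2 = r0\<^sup>2 \<longleftrightarrow> q = r0"
        using pq r2 by (auto intro!: power2_eq_iff_nonneg)
      ultimately show "s = S" by (auto simp: s_def S_def)
    qed
    finally show "d = artanh (L * (r0 + r0') / (1 + L\<^sup>2 * r0 * r0')) \<longleftrightarrow> p = r0 \<or> p = r0'"
      unfolding f .
  }
qed

section \<open>Lambert quadrilaterals\<close>

text \<open>Moving \<open>a\<close> to 0 puts \<open>b\<close> and \<open>d\<close> at
  \<open>X\<close> and \<open>Y\<close> on perpendicular diameters. The right angles at
  \<open>b\<close> and \<open>d\<close> give the inner products of \<open>X\<close> and
  \<open>Y\<close> with the image \<open>C\<close> of \<open>c\<close>, and with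
  \<open>L = 2 * norm C / (1 + (norm C)\<^sup>2)\<close> they become
  \<open>2 * x / (1 + x\<^sup>2) = L * cos \<theta>\<close> and
  \<open>2 * y / (1 + y\<^sup>2) = L * sin \<theta>\<close>. The left sides are the hyperbolic
  tangents of the lengths of the sides \<open>ab\<close> and \<open>ad\<close>, which are common
  perpendiculars.\<close>

lemma lambert_normal_form:
  fixes a b c d :: complex
  assumes quad: "hyp_quadrilateral a b c d"
    and angle_a: "ccw_angle a b d = pi / 2" and angle_b: "ccw_angle b c a = pi / 2"
    and angle_d: "ccw_angle d a c = pi / 2"
  defines "\<theta> \<equiv> ccw_angle a b c"
    and "L \<equiv> if c \<in> unit_disk then tanh (hyp_dist a c) else 1"
  shows "norm c \<le> 1" and "c \<noteq> a"
    and "0 < \<theta>" and "\<theta> < pi / 2" and "0 < L" and "L \<le> 1"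
    and "hyp_setdist (hyp_J a d) (hyp_J b c) = artanh (L * cos \<theta>)"
    and "hyp_setdist (hyp_J a b) (hyp_J c d) = artanh (L * sin \<theta>)"
proof -
  obtain g1 g2 g3 g4 where
    g: "geodesic_arc g1 a b" "geodesic_arc g2 b c" "geodesic_arc g3 c d" "geodesic_arc g4 d a"
    using quad unfolding hyp_quadrilateral_def by blast
  note g' = g[THEN geodesic_arc_reverse]
  have le: "norm a \<le> 1" "norm b \<le> 1" "norm c \<le> 1" "norm d \<le> 1"
    using quad unfolding hyp_quadrilateral_def by auto
  have ne: "b \<noteq> a" "c \<noteq> b" "c \<noteq> d" "d \<noteq> a"
    using g by (auto simp: geodesic_arc_def dest: arc_distinct_ends)
  \<comment> \<open>A vertex on the unit circle would have angle 0 instead of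
    \<open>pi / 2\<close>.\<close>
  have "norm a \<noteq> 1" "norm b \<noteq> 1" "norm d \<noteq> 1"
    using ccw_angle_boundary[OF _ g(1) g'(4)] ccw_angle_boundary[OF _ g(2) g'(1)]
      ccw_angle_boundary[OF _ g(4) g'(3)] angle_a angle_b angle_d by auto
  then have lt: "norm a < 1" "norm b < 1" "norm d < 1" using le by auto
  show "norm c \<le> 1" by fact
  define X Y C where "X = mob a b" and "Y = mob a d" and "C = mob a c"
  define x y where "x = norm X" and "y = norm Y"
  have X0: "X \<noteq> 0" "Y \<noteq> 0" using mob_eq_0_iff lt le ne by (auto simp: X_def Y_def)
  have xy: "0 < x" "x < 1" "0 < y" "y < 1"
    using X0 norm_mob_less_1 lt by (auto simp: x_def y_def X_def Y_def)
  have quotient: "mob p w = \<i> * of_real (norm (mob p w / mob p v)) * mob p v"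
    if "ccw_angle p v w = pi / 2" "norm p < 1" "norm v \<le> 1" "norm w \<le> 1" "v \<noteq> p" "w \<noteq> p" for p v w
  proof -
    have "mob p v \<noteq> 0" using mob_eq_0_iff that by simp
    moreover have "mob p w / mob p v = \<i> * of_real (norm (mob p w / mob p v))"
      by (rule Arg2pi_eq_pi_half) (use that ccw_angle_eq in metis)
    ultimately show ?thesis by (metis nonzero_eq_divide_eq)
  qed
  have inverse_quotient: "v = \<i> * of_real (- inverse k) * w"
    if "w = \<i> * of_real k * v" "w \<noteq> 0" for v w :: complex and k
    using that by (auto simp: field_simps)
  define s where "s = norm (Y / X)"
  have Y: "mob a d = \<i> * of_real s * mob a b"
    unfolding s_def X_def Y_def using quotient angle_a lt le ne by auto
  then have X: "mob a b = \<i> * of_real (- inverse s) * mob a d"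
    using inverse_quotient X0 Y_def by blast
  have s: "s > 0" "y = s * x" using X0 by (auto simp: s_def x_def y_def norm_divide)
  \<comment> \<open>At \<open>b\<close> the angle is swept from \<open>c\<close> to
    \<open>a\<close>, so the quotient expresses \<open>mob b a\<close> through
    \<open>mob b c\<close>; inverting it makes the coefficient \<open>k\<close> negative.\<close>
  have "mob b a = \<i> * of_real (norm (mob b a / mob b c)) * mob b c"
    using quotient angle_b lt le ne by auto
  moreover have "mob b a \<noteq> 0" using mob_eq_0_iff lt le ne by auto
  ultimately obtain k where k: "mob b c = \<i> * of_real k * mob b a"
    using inverse_quotient by blast
  obtain k' where k': "mob d c = \<i> * of_real k' * mob d a"
    using quotient[OF angle_d] lt le ne by auto
  have eqX: "(1 + x\<^sup>2) * (X \<bullet> C) = x\<^sup>2 * (1 + (norm C)\<^sup>2)"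
    unfolding x_def by (rule orthogonal_side_equation[OF lt(1,2) le(3) k X_def C_def])
  have eqY: "(1 + y\<^sup>2) * (Y \<bullet> C) = y\<^sup>2 * (1 + (norm C)\<^sup>2)"
    unfolding y_def by (rule orthogonal_side_equation[OF lt(1,3) le(3) k' Y_def C_def])
  \<comment> \<open>The two side equations thus place \<open>C\<close> in the open quadrant spanned
    by \<open>X\<close> and \<open>Y\<close>, which confines \<theta> to the open interval from 0 to
    \<open>pi / 2\<close>.\<close>
  have "0 < x\<^sup>2 * (1 + (norm C)\<^sup>2)" "0 < y\<^sup>2 * (1 + (norm C)\<^sup>2)"
    using xy by (auto simp: add_pos_nonneg)
  then have pos: "0 < X \<bullet> C" "0 < Y \<bullet> C"
    unfolding eqX[symmetric] eqY[symmetric]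
    by (auto elim!: zero_less_mult_pos intro: add_pos_nonneg)
  then have "C \<noteq> 0" by auto
  then show "c \<noteq> a" by (auto simp: C_def)
  have \<theta>: "\<theta> = Arg2pi (C / X)"
    unfolding \<theta>_def C_def X_def using ccw_angle_eq lt le ne \<open>c \<noteq> a\<close> by auto
  have norm_CX: "norm (C / X) = norm C / x" by (simp add: norm_divide x_def)
  have CX: "C / X = cnj X * C / of_real (x\<^sup>2)"
    using X0(1) complex_norm_square[of X] by (simp add: x_def field_simps)
  have "x\<^sup>2 > 0" using xy by simp
  have Re_CX: "Re (C / X) = X \<bullet> C / x\<^sup>2"
    unfolding CX Re_divide_of_real by (simp add: inner_complex_def)
  have "Y \<bullet> C = s * Im (cnj X * C)"
    using Y by (simp add: X_def[symmetric] Y_def[symmetric] inner_complex_def algebra_simps)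
  then have Im_CX: "Im (C / X) = Y \<bullet> C / (s * x\<^sup>2)"
    unfolding CX Im_divide_of_real using s by simp
  have cos: "norm C * cos \<theta> = X \<bullet> C / x"
    using cos_Arg2pi[of "C / X"] xy unfolding \<theta> Re_CX norm_CX
    by (simp add: field_simps power2_eq_square)
  have sin: "norm C * sin \<theta> = Y \<bullet> C / y"
    using sin_Arg2pi[of "C / X"] xy s unfolding \<theta> Im_CX norm_CX
    by (simp add: field_simps power2_eq_square)
  have "0 < norm C * cos \<theta>" "0 < norm C * sin \<theta>" unfolding cos sin using pos xy by auto
  then have cs: "0 < cos \<theta>" "0 < sin \<theta>" using \<open>C \<noteq> 0\<close> by (auto simp: zero_less_mult_iff)
  have \<theta>_bounds: "0 \<le> \<theta>" "\<theta> < 2 * pi" using Arg2pi[of "C / X"] by (auto simp: \<theta>)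
  have "\<theta> \<noteq> 0" using cs by auto
  then show "0 < \<theta>" using \<theta>_bounds by simp
  have "\<theta> < pi" using cs(2) \<theta>_bounds sin_le_zero[of \<theta>] by linarith
  show "\<theta> < pi / 2"
  proof (rule ccontr)
    assume "\<not> \<theta> < pi / 2"
    then have "cos \<theta> \<le> cos (pi / 2)" using \<open>\<theta> < pi\<close> by (intro cos_monotone_0_pi_le) auto
    then show False using cs by simp
  qed
  \<comment> \<open>For \<open>c\<close> in the open disk this is the doubling formula for
    \<open>tanh\<close>; on the unit circle \<open>norm C = 1\<close>, and the same expression gives
    the conventional value 1.\<close>
  have L: "L = 2 * norm C / (1 + (norm C)\<^sup>2)"
  proof (cases "norm c < 1")
    case True
    then show ?thesis
      using lt tanh_double_artanh(2)[of "norm C"] norm_mob_less_1[of a c]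
      by (simp add: L_def hyp_dist_eq_mob C_def)
  next
    case False
    then have "norm c = 1" using le by simp
    then have "1 - (norm C)\<^sup>2 = 0" unfolding C_def using lt le by (simp add: one_minus_norm_mob)
    then have "norm C = 1" by (simp add: abs_square_eq_1)
    then show ?thesis using False by (simp add: L_def)
  qed
  have C_pos: "1 + (norm C)\<^sup>2 > 0" by (simp add: add_pos_nonneg)
  then show "0 < L" unfolding L using \<open>C \<noteq> 0\<close> by simp
  have "2 * norm C \<le> 1 + (norm C)\<^sup>2"
    using zero_le_power2[of "1 - norm C"] by (simp add: power2_eq_square algebra_simps)
  then show "L \<le> 1" unfolding L using C_pos by simp
  \<comment> \<open>Used with \<open>t = x\<close>, \<open>u = cos \<theta>\<close> and with
    \<open>t = y\<close>, \<open>u = sin \<theta>\<close>: the side equation rearranges to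
    \<open>L * u = 2 * t / (1 + t\<^sup>2)\<close>.\<close>
  have distance: "2 * artanh t = artanh (L * u)"
    if "norm C * u = W / t" "(1 + t\<^sup>2) * W = t\<^sup>2 * (1 + (norm C)\<^sup>2)" "0 < t" "t < 1" for t u W
  proof -
    have "1 + t\<^sup>2 > 0" by (simp add: add_pos_nonneg)
    have W: "norm C * u * t = W" using that(1,3) by simp
    have "t * ((1 + t\<^sup>2) * (norm C * u)) = t * (t * (1 + (norm C)\<^sup>2))"
      using that(2) unfolding W[symmetric] by algebra
    then have "(1 + t\<^sup>2) * (norm C * u) = t * (1 + (norm C)\<^sup>2)" using that(3) by simp
    then have "L * u = 2 * t / (1 + t\<^sup>2)"
      unfolding L using C_pos \<open>1 + t\<^sup>2 > 0\<close> by (simp add: frac_eq_eq) algebra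
    then show ?thesis using tanh_double_artanh(1)[of t] that by simp
  qed
  have "hyp_setdist (hyp_J a d) (hyp_J b c) = hyp_dist a b"
    using hyp_setdist_common_perpendicular[OF lt(1,2) ne(1) le(3) ne(2) le(4) ne(4) Y k] .
  also have "\<dots> = 2 * artanh x" using lt by (simp add: hyp_dist_eq_mob x_def X_def)
  finally show "hyp_setdist (hyp_J a d) (hyp_J b c) = artanh (L * cos \<theta>)"
    using distance[OF cos eqX] xy by simp
  have "hyp_setdist (hyp_J a b) (hyp_J c d) = hyp_dist a d"
    using hyp_setdist_common_perpendicular[OF lt(1,3) ne(4) le(3) ne(3) le(2) ne(1) X k']
    by (simp add: hyp_J_commute[of c d])
  also have "\<dots> = 2 * artanh y" using lt by (simp add: hyp_dist_eq_mob y_def Y_def)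
  finally show "hyp_setdist (hyp_J a b) (hyp_J c d) = artanh (L * sin \<theta>)"
    using distance[OF sin eqY] xy by simp
qed

theorem theorem1p2:
  fixes va vb vc vd :: complex and \<phi> d1 d2 L m r0 r0' :: real
  assumes "lambert_quadrilateral va vb vc vd"
    and "0 \<le> \<phi>" and "\<phi> < pi / 2"
    and "interior_angle vd va vb = pi / 2"
    and "interior_angle va vb vc = pi / 2"
    and "interior_angle vb vc vd = \<phi>"
    and "interior_angle vc vd va = pi / 2"
    and "d1 = hyp_setdist (hyp_J va vd) (hyp_J vb vc)"
    and "d2 = hyp_setdist (hyp_J va vb) (hyp_J vc vd)"
    and "L = (if vc \<in> unit_disk then tanh (hyp_dist va vc) else 1)"
    and "L > sqrt (2 / 3) \<Longrightarrow> m = sqrt ((2 - L\<^sup>2) * (3 * L\<^sup>2 - 2))"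
    and "L > sqrt (2 / 3) \<Longrightarrow> r0 = sqrt ((1 - m / L\<^sup>2) / 2)"
    and "L > sqrt (2 / 3) \<Longrightarrow> r0' = sqrt (1 - r0\<^sup>2)"
  shows "0 < L \<and> L \<le> 1 \<and>
    (L \<le> sqrt (2 / 3) \<longrightarrow>
       artanh L < d1 + d2 \<and>
       d1 + d2 \<le> artanh (2 * sqrt 2 * L / (2 + L\<^sup>2)) \<and>
       (d1 + d2 = artanh (2 * sqrt 2 * L / (2 + L\<^sup>2)) \<longleftrightarrow> vc \<in> angle_bisector va vb vd)) \<and>
    (sqrt (2 / 3) < L \<and> L < sqrt (2 * (sqrt 2 - 1)) \<longrightarrow>
       artanh L < d1 + d2 \<and>
       d1 + d2 \<le> artanh (L * (r0 + r0') / (1 + L\<^sup>2 * r0 * r0')) \<and>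
       (d1 + d2 = artanh (L * (r0 + r0') / (1 + L\<^sup>2 * r0 * r0')) \<longleftrightarrow>
          ccw_angle va vb vc = arccos r0 \<or> ccw_angle va vb vc = arccos r0')) \<and>
    (sqrt (2 * (sqrt 2 - 1)) \<le> L \<and> L < 1 \<longrightarrow>
       artanh (2 * sqrt 2 * L / (2 + L\<^sup>2)) \<le> d1 + d2 \<and>
       d1 + d2 \<le> artanh (L * (r0 + r0') / (1 + L\<^sup>2 * r0 * r0')) \<and>
       (d1 + d2 = artanh (2 * sqrt 2 * L / (2 + L\<^sup>2)) \<longleftrightarrow> vc \<in> angle_bisector va vb vd) \<and>
       (d1 + d2 = artanh (L * (r0 + r0') / (1 + L\<^sup>2 * r0 * r0')) \<longleftrightarrow>
          ccw_angle va vb vc = arccos r0 \<or> ccw_angle va vb vc = arccos r0')) \<and>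
    (L = 1 \<longrightarrow>
       artanh (2 * sqrt 2 / 3) \<le> d1 + d2 \<and>
       (d1 + d2 = artanh (2 * sqrt 2 / 3) \<longleftrightarrow> vc \<in> angle_bisector va vb vd))"
proof -
  have quad: "hyp_quadrilateral va vb vc vd"
    using assms(1) unfolding lambert_quadrilateral_def by blast
  have angles: "ccw_angle va vb vd = pi / 2" "ccw_angle vb vc va = pi / 2" "ccw_angle vd va vc = pi / 2"
    using assms(4,5,7) unfolding interior_angle_def by auto
  define \<theta> where "\<theta> = ccw_angle va vb vc"
  note nf = lambert_normal_form[OF quad angles, folded assms(10) \<theta>_def]
  have cs: "0 < cos \<theta>" "0 < sin \<theta>"
    using nf(3,4) by (auto intro: cos_gt_zero sin_gt_zero)
  have d: "d1 + d2 = artanh (L * cos \<theta>) + artanh (L * sin \<theta>)"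
    using assms(8,9) nf(7,8) by simp
  note bounds = lambert_depth_bounds[OF cs sin_cos_squared_add2 nf(5,6) d assms(11-13)]
  \<comment> \<open>The angle at \<open>va\<close> is right, so the bisector means
    \<open>\<theta> = pi / 4\<close>, that is, \<theta> equals its complement; cosine is injective
    on the range of both.\<close>
  have bisector: "vc \<in> angle_bisector va vb vd \<longleftrightarrow> cos \<theta> = sin \<theta>"
  proof -
    have "vc \<in> angle_bisector va vb vd \<longleftrightarrow> \<theta> = pi / 4"
      using nf(1,2) angles(1) by (auto simp: angle_bisector_def \<theta>_def)
    also have "\<dots> \<longleftrightarrow> \<theta> = pi / 2 - \<theta>" by auto
    also have "\<dots> \<longleftrightarrow> cos \<theta> = cos (pi / 2 - \<theta>)"
    proof (rule iffI, erule arg_cong)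
      assume "cos \<theta> = cos (pi / 2 - \<theta>)"
      then show "\<theta> = pi / 2 - \<theta>" by (rule cos_inj_pi[rotated 4]) (use nf(3,4) in auto)
    qed
    finally show ?thesis by (simp add: cos_sin_eq[symmetric] sin_cos_eq)
  qed
  have arccos: "\<theta> = arccos r \<longleftrightarrow> cos \<theta> = r" if "0 \<le> r \<and> r \<le> 1" for r
    using that nf(3,4) by (auto simp: arccos_cos)
  \<comment> \<open>These bounds are what places \<open>2 * (sqrt 2 - 1)\<close> strictly between
    2/3 and 1.\<close>
  have sqrt2: "4 / 3 < sqrt 2" "sqrt 2 < 3 / 2"
    by (rule real_less_rsqrt, simp add: power2_eq_square)
      (rule real_less_lsqrt; simp add: power2_eq_square)
  then have "2 / 3 < 2 * (sqrt 2 - 1)" "2 * (sqrt 2 - 1) < 1"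
    by (simp_all add: field_simps)
  then have thresholds: "sqrt (2 / 3) < sqrt (2 * (sqrt 2 - 1))" "sqrt (2 * (sqrt 2 - 1)) < 1"
    by simp_all
  have unit: "2 * sqrt 2 * L / (2 + L\<^sup>2) = 2 * sqrt 2 / 3" if "L = 1"
    using that by simp
  show ?thesis
  proof (intro conjI impI)
    show "0 < L" "L \<le> 1" by (rule nf)+
  next
    assume "L \<le> sqrt (2 / 3)"
    then have 1: "L \<le> sqrt (2 / 3)" "L < 1" "L < sqrt (2 * (sqrt 2 - 1))"
      using thresholds by linarith+
    show "artanh L < d1 + d2" using bounds(1) 1 by blast
    show "d1 + d2 \<le> artanh (2 * sqrt 2 * L / (2 + L\<^sup>2))" using bounds(2) 1 by blast
    show "d1 + d2 = artanh (2 * sqrt 2 * L / (2 + L\<^sup>2)) \<longleftrightarrow> vc \<in> angle_bisector va vb vd"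
      unfolding bisector using bounds(4) 1 by blast
  next
    assume "sqrt (2 / 3) < L \<and> L < sqrt (2 * (sqrt 2 - 1))"
    then have 2: "sqrt (2 / 3) < L" "L < sqrt (2 * (sqrt 2 - 1))" "L < 1" using thresholds by linarith+
    show "artanh L < d1 + d2" using bounds(1) 2 by blast
    show "d1 + d2 \<le> artanh (L * (r0 + r0') / (1 + L\<^sup>2 * r0 * r0'))" using bounds(5) 2 by blast
    show "d1 + d2 = artanh (L * (r0 + r0') / (1 + L\<^sup>2 * r0 * r0')) \<longleftrightarrow>
        ccw_angle va vb vc = arccos r0 \<or> ccw_angle va vb vc = arccos r0'"
      using bounds(6,7) 2(1,3) arccos unfolding \<theta>_def by blast
  next
    assume "sqrt (2 * (sqrt 2 - 1)) \<le> L \<and> L < 1"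
    then have 3: "sqrt (2 / 3) < L" "sqrt (2 * (sqrt 2 - 1)) \<le> L" "L < 1" using thresholds by linarith+
    show "artanh (2 * sqrt 2 * L / (2 + L\<^sup>2)) \<le> d1 + d2" using bounds(3) 3 by blast
    show "d1 + d2 \<le> artanh (L * (r0 + r0') / (1 + L\<^sup>2 * r0 * r0'))" using bounds(5) 3 by blast
    show "d1 + d2 = artanh (2 * sqrt 2 * L / (2 + L\<^sup>2)) \<longleftrightarrow> vc \<in> angle_bisector va vb vd"
      unfolding bisector using bounds(4) 3 by blast
    show "d1 + d2 = artanh (L * (r0 + r0') / (1 + L\<^sup>2 * r0 * r0')) \<longleftrightarrow>
        ccw_angle va vb vc = arccos r0 \<or> ccw_angle va vb vc = arccos r0'"
      using bounds(6,7) 3(1,3) arccos unfolding \<theta>_def by blast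
  next
    assume 4: "L = 1"
    then have "sqrt (2 * (sqrt 2 - 1)) \<le> L" using thresholds by linarith
    then show "artanh (2 * sqrt 2 / 3) \<le> d1 + d2"
      "d1 + d2 = artanh (2 * sqrt 2 / 3) \<longleftrightarrow> vc \<in> angle_bisector va vb vd"
      unfolding bisector unit[OF 4, symmetric] using bounds(3,4) by blast+
  qed
qed

end
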